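(* Let $\sigma>0$ and let $f,g$ be functions of $x>0$ such that, for some constant $A$, $$\frac{x^2}{4}\left(\frac{f(x)\ln x}{x}\right)''+\frac{f(x)}{4\sigma}\left(\left(\frac{f(x)\ln x}{x}\right)'-\frac{\sigma}{x}\right)+\frac{x\ln x\,g'(x)}{2}+g(x)=A.$$ Let $u_0(x)$ be a stationary solution of $$u_t=\sigma x^2u_{xx}+f(x)u_x-g(x)u \tag{$*$}$$ analytic near zero. Then there is a fundamental solution $p(t,x,y)$ of $( * )$ such that (for $\varepsilon\ge 0$) $$\int_0^\infty e^{-\frac{\varepsilon}{\sigma}(\ln y)^2}p(t,x,y)u_0(y)\,dy=U_\varepsilon(x,t),$$ where $$U_\varepsilon(x,t)=\frac{1}{\sqrt{1+4\varepsilon t}}\exp\left\{-\frac{\varepsilon\left((\ln x)^2+2\sigma t\ln x+(4A+\sigma)\sigma t^2\right)}{\sigma(1+4\varepsilon t)}\right\}\exp\left\{\frac{1}{2\sigma}\left(F\left(\frac{\ln x}{1+4\varepsilon t}\right)-F(\ln x)\right)\right\}u_0\left(x^{\frac{1}{1+4\varepsilon t}}\right)$$ and $F'(z)=e^{-z}f(e^{z})$.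
   Context: A stationary solution is a time-independent solution $u_0(x)$ of the PDE. A fundamental solution of the PDE is a kernel $p(t,x,y)$, $t>0$, $x,y>0$ (a function, or possibly a distribution in $y$) such that for suitable initial data $\varphi$ the function $u(x,t)=\int_0^\infty\varphi(y)p(t,x,y)\,dy$ solves the PDE for $t>0$ and satisfies $u(x,0)=\varphi(x)$. Fundamental solutions need not be unique.
   Formalization: In the first exponent of U_ε the term +2σt ln x is corrected to −2σt ln x; with the plus sign the claim fails for f=g=0, σ=1, A=0, F=0, u_0=1, where the solution with datum exp(−ε(ln x)²) involves (ln x − t)². *)

theory Defs
  imports "HOL-Analysis.Analysis"
begin

text \<open>Classical solutions of \<open>u\<^sub>t = \<sigma> x\<^sup>2 u\<^sub>x\<^sub>x + f(x) u\<^sub>x - g(x) u\<close> on \<open>x > 0\<close>, \<open>t > 0\<close>.\<close>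

definition solves_pde ::
  "real \<Rightarrow> (real \<Rightarrow> real) \<Rightarrow> (real \<Rightarrow> real) \<Rightarrow> (real \<Rightarrow> real \<Rightarrow> real) \<Rightarrow> bool" where
  "solves_pde \<sigma> f g u \<longleftrightarrow>
     (\<exists>ux uxx ut. \<forall>x>0. \<forall>t>0.
        ((\<lambda>x. u x t) has_real_derivative ux x t) (at x) \<and>
        ((\<lambda>x. ux x t) has_real_derivative uxx x t) (at x) \<and>
        ((\<lambda>t. u x t) has_real_derivative ut x t) (at t) \<and>
        ut x t = \<sigma> * x\<^sup>2 * uxx x t + f x * ux x t - g x * u x t)"

definition stationary_solution ::
  "real \<Rightarrow> (real \<Rightarrow> real) \<Rightarrow> (real \<Rightarrow> real) \<Rightarrow> (real \<Rightarrow> real) \<Rightarrow> bool" where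
  "stationary_solution \<sigma> f g u0 \<longleftrightarrow> solves_pde \<sigma> f g (\<lambda>x t. u0 x)"

text \<open>The functions live on \<open>x > 0\<close> only, so analyticity near zero means that \<open>u0\<close> is the
  restriction of a convergent power series about \<open>0\<close>.\<close>

definition analytic_near_zero :: "(real \<Rightarrow> real) \<Rightarrow> bool" where
  "analytic_near_zero u0 \<longleftrightarrow>
     (\<exists>r>0. \<exists>a. \<forall>x. 0 < x \<and> x < r \<longrightarrow> (\<lambda>n. a n * x ^ n) sums u0 x)"

text \<open>The suitable initial data for a kernel are the continuous functions on \<open>{0<..}\<close> whose
  integral against it converges absolutely for all \<open>x, t > 0\<close>.\<close>

definition suitable_data :: "(real \<Rightarrow> real \<Rightarrow> real \<Rightarrow> real) \<Rightarrow> (real \<Rightarrow> real) \<Rightarrow> bool" where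
  "suitable_data p \<phi> \<longleftrightarrow> continuous_on {0<..} \<phi> \<and>
     (\<forall>t>0. \<forall>x>0. set_integrable lborel {0<..} (\<lambda>y. \<phi> y * p t x y))"

definition kernel_integral ::
  "(real \<Rightarrow> real \<Rightarrow> real \<Rightarrow> real) \<Rightarrow> (real \<Rightarrow> real) \<Rightarrow> real \<Rightarrow> real \<Rightarrow> real" where
  "kernel_integral p \<phi> x t = (LBINT y:{0<..}. \<phi> y * p t x y)"

text \<open>The first conjunct (all continuous data with compact support in \<open>{0<..}\<close> are suitable)
  excludes kernels for which hardly any datum is suitable. The initial condition is attained
  as a joint limit \<open>(x, t) \<rightarrow> (x0, 0+)\<close>.\<close>

definition fundamental_solution ::
  "real \<Rightarrow> (real \<Rightarrow> real) \<Rightarrow> (real \<Rightarrow> real) \<Rightarrow> (real \<Rightarrow> real \<Rightarrow> real \<Rightarrow> real) \<Rightarrow> bool" where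
  "fundamental_solution \<sigma> f g p \<longleftrightarrow>
     (\<forall>\<phi> a b. continuous_on {0<..} \<phi> \<and> 0 < a \<and> (\<forall>y>0. y \<notin> {a..b} \<longrightarrow> \<phi> y = 0)
        \<longrightarrow> suitable_data p \<phi>) \<and>
     (\<forall>\<phi>. suitable_data p \<phi> \<longrightarrow>
        solves_pde \<sigma> f g (kernel_integral p \<phi>) \<and>
        (\<forall>x0>0. ((\<lambda>(x, t). kernel_integral p \<phi> x t) \<longlongrightarrow> \<phi> x0)
                  (at (x0, 0) within {0<..} \<times> {0<..})))"

text \<open>The term linear in \<open>t\<close> in the first exponential is \<open>- 2 \<sigma> t ln x\<close>. With \<open>+ 2 \<sigma> t ln x\<close>,
  which is also found in print, \<open>U\<close> does not solve the equation: take \<open>f = g = 0\<close>, \<open>A = 0\<close>,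
  \<open>F = 0\<close>, \<open>u0 = 1\<close>, where \<open>u\<^sub>t = \<sigma> (u\<^sub>z\<^sub>z - u\<^sub>z)\<close> in \<open>z = ln x\<close> and the solution with initial
  value \<open>exp (- \<epsilon> z\<^sup>2 / \<sigma>)\<close> involves \<open>(z - \<sigma> t)\<^sup>2\<close>.\<close>

definition U ::
  "real \<Rightarrow> real \<Rightarrow> (real \<Rightarrow> real) \<Rightarrow> (real \<Rightarrow> real) \<Rightarrow> real \<Rightarrow> real \<Rightarrow> real \<Rightarrow> real" where
  "U \<sigma> A F u0 \<epsilon> x t =
     1 / sqrt (1 + 4 * \<epsilon> * t)
     * exp (- (\<epsilon> * ((ln x)\<^sup>2 - 2 * \<sigma> * t * ln x + (4 * A + \<sigma>) * \<sigma> * t\<^sup>2)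
               / (\<sigma> * (1 + 4 * \<epsilon> * t))))
     * exp (1 / (2 * \<sigma>) * (F (ln x / (1 + 4 * \<epsilon> * t)) - F (ln x)))
     * u0 (x powr (1 / (1 + 4 * \<epsilon> * t)))"

end

theory Submission
  imports Defs "HOL-Probability.Probability"
begin

text \<open>
  Put \<open>z = ln x\<close>, \<open>\<phi> = F'\<close> and \<open>\<Phi> z = (F z - \<sigma> z) / (2 \<sigma>)\<close>. Substituting
  \<open>u = exp (- \<Phi>) w\<close> turns the equation into \<open>w\<^sub>t = \<sigma> w\<^sub>z\<^sub>z - V w\<close>, and the hypothesis on \<open>f\<close> and \<open>g\<close>
  says that \<open>z\<^sup>2 (V - B)\<close> has derivative 0, where \<open>B = A + \<sigma> / 4\<close>. This function vanishes at
  \<open>z = 0\<close>, so \<open>V\<close> is the constant \<open>B\<close>, and conjugating the heat kernel by \<open>exp \<Phi>\<close> and damping it by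
  \<open>exp (- B t)\<close> gives a fundamental solution. A stationary \<open>u0\<close> corresponds to a solution of
  \<open>\<sigma> w'' = B w\<close>. Gaussian averages multiply such a \<open>w\<close> by a constant, and completing the square in
  the product of \<open>exp (- \<epsilon> y\<^sup>2 / \<sigma>)\<close> with the heat kernel leaves a Gaussian average of \<open>w\<close>
  around \<open>z / (1 + 4 \<epsilon> t)\<close>.\<close>

section \<open>Exponential integrals and changes of variables\<close>

text \<open>By \<open>d * \<bar>k\<bar> \<le> exp (d * \<bar>k\<bar>)\<close>, a factor
  \<open>k\<close> costs only one further exponential; the two signs on the right cover both signs
  of \<open>k\<close>. This yields the majorant for differentiating under the integral.\<close>

lemma abs_mult_exp_le:
  fixes k h d :: real
  assumes "\<bar>h\<bar> \<le> d" "d > 0"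
  shows "\<bar>k\<bar> * exp (h * k) \<le> (exp (2 * d * k) + exp (- (2 * d) * k)) / d"
proof -
  have "d * \<bar>k\<bar> \<le> exp (d * \<bar>k\<bar>)" using exp_ge_add_one_self[of "d * \<bar>k\<bar>"] by linarith
  hence 1: "\<bar>k\<bar> \<le> exp (d * \<bar>k\<bar>) / d" using assms by (simp add: field_simps)
  have "h * k \<le> \<bar>h\<bar> * \<bar>k\<bar>" by (metis abs_ge_self abs_mult)
  also have "\<dots> \<le> d * \<bar>k\<bar>" using assms by (simp add: mult_right_mono)
  finally have 2: "exp (h * k) \<le> exp (d * \<bar>k\<bar>)" by simp
  have "\<bar>k\<bar> * exp (h * k) \<le> exp (d * \<bar>k\<bar>) / d * exp (d * \<bar>k\<bar>)"
    using 1 2 assms by (intro mult_mono) auto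
  also have "\<dots> = exp (2 * d * \<bar>k\<bar>) / d" by (simp add: exp_add[symmetric])
  also have "\<dots> \<le> (exp (2 * d * k) + exp (- (2 * d) * k)) / d"
    using assms by (intro divide_right_mono) (auto simp: abs_if)
  finally show ?thesis .
qed

text \<open>Dominated convergence applies because integrability at \<open>r0 + 2 * d\<close> and
  \<open>r0 - 2 * d\<close> absorbs the factor \<open>k\<close>. With \<open>k\<close> arbitrary,
  one lemma covers both position (\<open>k y = y\<close>) and precision
  (\<open>k y = - (z - y)^2\<close>). Its first conclusion has the shape of its hypothesis with
  \<open>\<theta>\<close> replaced by \<open>k * \<theta>\<close>, so it can be iterated.\<close>

lemma exponential_integral_deriv:
  fixes k \<theta> :: "'a \<Rightarrow> real" and M :: "'a measure" and r0 \<delta> :: real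
  assumes \<delta>: "\<delta> > 0" and k[measurable]: "k \<in> borel_measurable M"
    and int: "\<And>r. \<bar>r - r0\<bar> < \<delta> \<Longrightarrow> integrable M (\<lambda>y. exp (r * k y) * \<theta> y)"
  shows "integrable M (\<lambda>y. exp (r0 * k y) * (k y * \<theta> y))"
    and "((\<lambda>r. \<integral>y. exp (r * k y) * \<theta> y \<partial>M) has_real_derivative
           (\<integral>y. exp (r0 * k y) * (k y * \<theta> y) \<partial>M)) (at r0)"
proof -
  define d where "d = \<delta> / 4"
  have d: "d > 0" "2 * d < \<delta>" using \<delta> by (auto simp: d_def)
  have m: "(\<lambda>y. exp (r0 * k y) * \<theta> y) \<in> borel_measurable M"
    using borel_measurable_integrable[OF int[of r0]] \<delta> by simp
  \<comment> \<open>Measurability of \<open>\<theta>\<close> is recovered by cancelling the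
    exponential from the integrand at \<open>r0\<close>.\<close>
  have "(\<lambda>y. exp (- r0 * k y) * (exp (r0 * k y) * \<theta> y)) \<in> borel_measurable M"
    by (rule borel_measurable_times[OF _ m]) measurable
  also have "(\<lambda>y. exp (- r0 * k y) * (exp (r0 * k y) * \<theta> y)) = \<theta>"
    by (simp add: mult.assoc[symmetric] exp_add[symmetric])
  finally have [measurable]: "\<theta> \<in> borel_measurable M" .
  define w where "w y = (exp ((r0 + 2 * d) * k y) * \<bar>\<theta> y\<bar> + exp ((r0 - 2 * d) * k y) * \<bar>\<theta> y\<bar>) / d" for y
  have w: "integrable M w"
  proof -
    have "integrable M (\<lambda>y. exp (r * k y) * \<bar>\<theta> y\<bar>)" if "\<bar>r - r0\<bar> < \<delta>" for r
      using integrable_abs[OF int[OF that]] by (simp add: abs_mult)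
    from this[of "r0 + 2*d"] this[of "r0 - 2*d"] show ?thesis
      unfolding w_def using d by (intro integrable_divide integrable_add) auto
  qed
  have bound: "\<bar>k y * exp ((r0 + h) * k y) * \<theta> y\<bar> \<le> w y" if "\<bar>h\<bar> \<le> d" for h y
  proof -
    have "\<bar>k y * exp ((r0 + h) * k y) * \<theta> y\<bar> = (\<bar>k y\<bar> * exp (h * k y)) * (exp (r0 * k y) * \<bar>\<theta> y\<bar>)"
      by (simp add: abs_mult exp_add algebra_simps)
    also have "\<dots> \<le> ((exp (2 * d * k y) + exp (- (2 * d) * k y)) / d) * (exp (r0 * k y) * \<bar>\<theta> y\<bar>)"
      using abs_mult_exp_le[OF that d(1)] by (intro mult_right_mono) auto
    also have "\<dots> = w y"
      by (simp add: w_def exp_add exp_diff exp_minus algebra_simps add_divide_distrib divide_inverse)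
    finally show ?thesis .
  qed
  show "integrable M (\<lambda>y. exp (r0 * k y) * (k y * \<theta> y))"
  proof (rule Bochner_Integration.integrable_bound[OF w])
    show "AE y in M. norm (exp (r0 * k y) * (k y * \<theta> y)) \<le> norm (w y)"
      using bound[of 0] d by (intro AE_I2) (simp add: mult_ac order_trans[OF _ abs_ge_self])
  qed simp
  show "((\<lambda>r. \<integral>y. exp (r * k y) * \<theta> y \<partial>M) has_real_derivative
           (\<integral>y. exp (r0 * k y) * (k y * \<theta> y) \<partial>M)) (at r0)"
    unfolding DERIV_def tendsto_at_iff_sequentially comp_def
  proof (intro allI impI)
    fix X :: "nat \<Rightarrow> real"
    assume X0: "\<forall>i. X i \<in> UNIV - {0}" and X: "X \<longlonglongrightarrow> 0"
    \<comment> \<open>Steps longer than \<open>d\<close> are replaced by \<open>d\<close>, so that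
      the bound holds at every index; only finitely many entries change, and the limit stays the
      same.\<close>
    define Y where "Y = (\<lambda>n. if \<bar>X n\<bar> \<le> d then X n else d)"
    have evX: "\<forall>\<^sub>F n in sequentially. X n = Y n"
      using tendstoD[OF X d(1)] by eventually_elim (auto simp: Y_def)
    have Y: "\<bar>Y n\<bar> \<le> d" "Y n \<noteq> 0" for n using X0 d by (auto simp: Y_def)
    have Ylim: "Y \<longlonglongrightarrow> 0" using X evX by (rule Lim_transform_eventually)
    define q where "q n y = (exp ((r0 + Y n) * k y) * \<theta> y - exp (r0 * k y) * \<theta> y) / Y n" for n y
    have "(\<lambda>n. \<integral>y. q n y \<partial>M) \<longlonglongrightarrow> (\<integral>y. exp (r0 * k y) * (k y * \<theta> y) \<partial>M)"
    proof (rule integral_dominated_convergence[where w = w])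
      show "AE y in M. (\<lambda>n. q n y) \<longlonglongrightarrow> exp (r0 * k y) * (k y * \<theta> y)"
      proof (rule AE_I2)
        fix y
        have "((\<lambda>r. exp (r * k y) * \<theta> y) has_real_derivative exp (r0 * k y) * (k y * \<theta> y)) (at r0)"
          by (auto intro!: derivative_eq_intros)
        then show "(\<lambda>n. q n y) \<longlonglongrightarrow> exp (r0 * k y) * (k y * \<theta> y)"
          unfolding DERIV_def tendsto_at_iff_sequentially comp_def q_def
          using Y Ylim by auto
      qed
    next
      fix n
      show "AE y in M. norm (q n y) \<le> w y"
      proof (rule AE_I2)
        fix y
        have der: "\<And>r. ((\<lambda>r. exp (r * k y) * \<theta> y) has_real_derivative k y * exp (r * k y) * \<theta> y) (at r)"
          by (auto intro!: derivative_eq_intros)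
        \<comment> \<open>Mean value inequality: \<open>w y\<close> bounds the derivative on the
          whole ball of radius \<open>d\<close>, hence every difference quotient.\<close>
        have "norm (exp ((r0 + Y n) * k y) * \<theta> y - exp (r0 * k y) * \<theta> y) \<le> w y * norm (r0 + Y n - r0)"
        proof (rule field_differentiable_bound[where S = "cball r0 d"])
          fix r assume "r \<in> cball r0 d"
          then show "norm (k y * exp (r * k y) * \<theta> y) \<le> w y"
            using bound[of "r - r0" y] by (auto simp: dist_real_def)
        qed (use der Y d in \<open>auto intro: has_field_derivative_at_within simp: dist_real_def\<close>)
        then show "norm (q n y) \<le> w y"
          using Y[of n] by (simp add: q_def field_simps)
      qed
    qed (use w in \<open>auto simp: q_def\<close>)
    moreover have "(\<integral>y. q n y \<partial>M) =
        ((\<integral>y. exp ((r0 + Y n) * k y) * \<theta> y \<partial>M) - (\<integral>y. exp (r0 * k y) * \<theta> y \<partial>M)) / Y n" for n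
      unfolding q_def using int[of r0] int[of "r0 + Y n"] Y[of n] d
      by (subst integral_divide_zero, subst Bochner_Integration.integral_diff) auto
    ultimately have "(\<lambda>n. ((\<integral>y. exp ((r0 + Y n) * k y) * \<theta> y \<partial>M) - (\<integral>y. exp (r0 * k y) * \<theta> y \<partial>M)) / Y n)
        \<longlonglongrightarrow> (\<integral>y. exp (r0 * k y) * (k y * \<theta> y) \<partial>M)" by simp
    then show "(\<lambda>n. ((\<integral>y. exp ((r0 + X n) * k y) * \<theta> y \<partial>M) - (\<integral>y. exp (r0 * k y) * \<theta> y \<partial>M)) / X n)
        \<longlonglongrightarrow> (\<integral>y. exp (r0 * k y) * (k y * \<theta> y) \<partial>M)"
      by (rule Lim_transform_eventually) (use evX in eventually_elim, simp)
  qed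
qed

text \<open>L'Hopital's rule for the difference quotient. It serves at \<open>z = 0\<close>, where a
  division by \<open>z\<close> leaves the derivative known only away from the point.\<close>

lemma has_real_derivative_limit:
  fixes f f' :: "real \<Rightarrow> real"
  assumes "isCont f a" and "\<And>x. x \<noteq> a \<Longrightarrow> (f has_real_derivative f' x) (at x)"
    and "(f' \<longlongrightarrow> l) (at a)"
  shows "(f has_real_derivative l) (at a)"
proof -
  have "((\<lambda>x. (f x - f a) / (x - a)) \<longlongrightarrow> l) (at a)"
  proof (rule lhopital)
    show "((\<lambda>x. f x - f a) \<longlongrightarrow> 0) (at a)" using assms(1) by (simp add: isCont_def LIM_zero_iff)
    show "((\<lambda>x. x - a) \<longlongrightarrow> 0) (at a)" by (simp add: LIM_zero_iff)
    show "\<forall>\<^sub>F x in at a. x - a \<noteq> 0" by (simp add: eventually_at_filter)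
    show "\<forall>\<^sub>F x in at a. (1::real) \<noteq> 0" by simp
    show "\<forall>\<^sub>F x in at a. ((\<lambda>x. f x - f a) has_real_derivative f' x) (at x)"
      unfolding eventually_at_filter
      by (intro always_eventually allI impI) (auto intro!: derivative_eq_intros assms(2))
    show "\<forall>\<^sub>F x in at a. ((\<lambda>x. x - a) has_real_derivative 1) (at x)"
      by (auto intro!: derivative_eq_intros always_eventually)
    show "((\<lambda>x. f' x / 1) \<longlongrightarrow> l) (at a)" using assms(3) by simp
  qed
  then show ?thesis by (simp add: has_field_derivative_iff)
qed

section \<open>The substitution \<open>y = exp z\<close> on the half-line\<close>

lemma set_lborel_integral_exp_substitution:
  fixes k :: "real \<Rightarrow> real"
  shows "set_integrable lborel {0<..} k \<Longrightarrow> integrable lborel (\<lambda>z. exp z * k (exp z))"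
    and "integrable lborel (\<lambda>z. exp z * k (exp z)) \<Longrightarrow> set_integrable lborel {0<..} k"
    and "integrable lborel (\<lambda>z. exp z * k (exp z)) \<Longrightarrow>
           (LBINT y:{0<..}. k y) = (\<integral>z. exp z * k (exp z) \<partial>lborel)"
proof -
  have cov: "((\<lambda>z. \<bar>exp z\<bar> * k (exp z)) absolutely_integrable_on UNIV \<and>
           integral UNIV (\<lambda>z. \<bar>exp z\<bar> * k (exp z)) = b)
     \<longleftrightarrow> (k absolutely_integrable_on (range exp) \<and> integral (range exp) k = b)" for b
    by (rule has_absolute_integral_change_of_variables_1') (auto intro!: derivative_eq_intros inj_onI)
  have range: "range exp = {0::real<..}"
    by (force simp: image_iff intro: exp_ln[symmetric])
  \<comment> \<open>The change-of-variables theorem concerns the completed measure. Returning to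
    \<open>lborel\<close> needs Borel measurability, which passes in either direction by composing
    with \<open>exp\<close> or \<open>ln\<close>.\<close>
  have meas: "(\<lambda>y. indicator {0<..} y *\<^sub>R k y) \<in> borel_measurable lborel \<longleftrightarrow>
      (\<lambda>z. exp z * k (exp z)) \<in> borel_measurable lborel" (is "?l \<longleftrightarrow> ?r")
  proof
    assume ?l
    then have "(\<lambda>z. exp z * (indicator {0<..} (exp z) *\<^sub>R k (exp z))) \<in> borel_measurable lborel"
      by (intro borel_measurable_times measurable_compose[OF _ \<open>?l\<close>[unfolded measurable_lborel2]])
        (auto simp del: indicator_simps)
    then show ?r by simp
  next
    assume ?r
    then have "(\<lambda>y. indicator {0<..} y *\<^sub>R (exp (ln y) * k (exp (ln y)) / y)) \<in> borel_measurable lborel"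
      by (intro borel_measurable_scaleR borel_measurable_divide measurable_compose[OF _ \<open>?r\<close>[simplified]]) auto
    also have "(\<lambda>y. indicator {0<..} y *\<^sub>R (exp (ln y) * k (exp (ln y)) / y)) =
        (\<lambda>y. indicator {0<..} y *\<^sub>R k y)"
      by (auto simp: fun_eq_iff indicator_def)
    finally show ?l .
  qed
  show 1: "integrable lborel (\<lambda>z. exp z * k (exp z))" if *: "set_integrable lborel {0<..} k"
  proof -
    have m: "(\<lambda>z. exp z * k (exp z)) \<in> borel_measurable lborel"
      using * meas by (auto simp: set_integrable_def)
    have "k absolutely_integrable_on {0<..}"
      using * unfolding set_integrable_def by (metis integrable_completion borel_measurable_integrable)
    with cov have "(\<lambda>z. exp z * k (exp z)) absolutely_integrable_on UNIV"
      unfolding range by auto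
    with m show ?thesis
      unfolding set_integrable_def by (subst (asm) integrable_completion) auto
  qed
  assume *: "integrable lborel (\<lambda>z. exp z * k (exp z))"
  have m: "(\<lambda>y. indicator {0<..} y *\<^sub>R k y) \<in> borel_measurable lborel"
    using * meas by auto
  have abs: "(\<lambda>z. exp z * k (exp z)) absolutely_integrable_on UNIV"
    unfolding set_integrable_def using * by (subst integrable_completion) auto
  with cov have k: "k absolutely_integrable_on {0<..}"
      "integral {0<..} k = integral UNIV (\<lambda>z. exp z * k (exp z))"
    unfolding range by auto
  then show **: "set_integrable lborel {0<..} k"
    using m unfolding set_integrable_def by (subst (asm) integrable_completion) auto
  have "(LBINT y:{0<..}. k y) = integral {0<..} k"
    using ** by (rule set_borel_integral_eq_integral)
  also have "\<dots> = (\<integral>z. exp z * k (exp z) \<partial>lborel)"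
    using k(2) integral_lborel[OF *] by simp
  finally show "(LBINT y:{0<..}. k y) = (\<integral>z. exp z * k (exp z) \<partial>lborel)" .
qed

section \<open>The heat equation on the line\<close>

definition heat_kernel :: "real \<Rightarrow> real \<Rightarrow> real \<Rightarrow> real" where
  "heat_kernel \<sigma> t z = exp (- z\<^sup>2 / (4 * \<sigma> * t)) / sqrt (4 * pi * \<sigma> * t)"

definition heat_integral :: "real \<Rightarrow> (real \<Rightarrow> real) \<Rightarrow> real \<Rightarrow> real \<Rightarrow> real" where
  "heat_integral \<sigma> \<psi> z t = (\<integral>y. heat_kernel \<sigma> t (z - y) * \<psi> y \<partial>lborel)"

lemma heat_kernel_normal_density:
  assumes "\<sigma> > 0" "t > 0"
  shows "heat_kernel \<sigma> t (z - y) = normal_density z (sqrt (2 * \<sigma> * t)) y"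
  using assms by (simp add: heat_kernel_def normal_density_def power2_commute mult_ac)

lemma heat_kernel_nonneg: "\<sigma> > 0 \<Longrightarrow> t > 0 \<Longrightarrow> 0 \<le> heat_kernel \<sigma> t z"
  by (simp add: heat_kernel_def)

text \<open>In terms of the precision \<open>s\<close> the exponent is linear in the parameter, so
  that time derivatives too become derivatives of exponential integrals.\<close>

lemma heat_kernel_precision:
  assumes "\<sigma> > 0" "t > 0" "s = 1 / (4 * \<sigma> * t)"
  shows "heat_kernel \<sigma> t z = sqrt (s / pi) * exp (- (s * z\<^sup>2))"
  using assms by (simp add: heat_kernel_def real_sqrt_divide real_sqrt_mult)

text \<open>This is what suitability of data becomes after the substitution. As every precision is
  allowed, all exponential moments against a Gaussian exist, even for unbounded
  \<open>\<psi>\<close>.\<close>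

locale gaussian_integrable =
  fixes \<psi> :: "real \<Rightarrow> real"
  assumes gaussian_integrable: "\<And>s z. s > 0 \<Longrightarrow> integrable lborel (\<lambda>y. exp (- (s * (z - y)\<^sup>2)) * \<psi> y)"
begin

text \<open>Completing the square: up to a constant factor, the weight is a Gaussian centred at
  \<open>r / (2 * s)\<close>.\<close>

lemma integrable_exp_linear:
  assumes "s > 0"
  shows "integrable lborel (\<lambda>y. exp (r * y) * (exp (- (s * y\<^sup>2)) * \<psi> y))"
proof -
  have "exp (r * y) * (exp (- (s * y\<^sup>2)) * \<psi> y)
      = exp (r\<^sup>2 / (4 * s)) * (exp (- (s * (r / (2 * s) - y)\<^sup>2)) * \<psi> y)" for y
  proof -
    have "r * y - s * y\<^sup>2 = r\<^sup>2 / (4 * s) - s * (r / (2 * s) - y)\<^sup>2"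
      using assms by (simp add: power2_eq_square field_simps)
    then show ?thesis by (simp add: mult.assoc[symmetric] exp_add[symmetric])
  qed
  then show ?thesis
    by (simp only:) (rule integrable_mult_right[OF gaussian_integrable[OF assms]])
qed

lemma integrable_exp_linear_mult:
  assumes "s > 0"
  shows "integrable lborel (\<lambda>y. exp (r * y) * (y * (exp (- (s * y\<^sup>2)) * \<psi> y)))"
    and "integrable lborel (\<lambda>y. exp (r * y) * (y * (y * (exp (- (s * y\<^sup>2)) * \<psi> y))))"
proof -
  show *: "integrable lborel (\<lambda>y. exp (r * y) * (y * (exp (- (s * y\<^sup>2)) * \<psi> y)))" for r
    by (rule exponential_integral_deriv(1)[OF zero_less_one _ integrable_exp_linear[OF assms]]) simp
  show "integrable lborel (\<lambda>y. exp (r * y) * (y * (y * (exp (- (s * y\<^sup>2)) * \<psi> y))))"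
    by (rule exponential_integral_deriv(1)[OF zero_less_one _ *]) simp
qed

text \<open>At fixed precision, expanding \<open>(z - y)^2\<close> makes \<open>z\<close> a
  parameter of a linear exponent, which gives the space derivatives. At fixed \<open>z\<close>, the
  precision multiplies \<open>- (z - y)^2\<close>, which gives the time derivative. The same second
  moment \<open>Q\<close> appears in both, and the heat equation follows by comparison.\<close>

lemma heat_equation:
  assumes \<sigma>: "\<sigma> > 0"
  obtains wz wzz where
    "\<And>z t. t > 0 \<Longrightarrow> ((\<lambda>z. heat_integral \<sigma> \<psi> z t) has_real_derivative wz z t) (at z)"
    "\<And>z t. t > 0 \<Longrightarrow> ((\<lambda>z. wz z t) has_real_derivative wzz z t) (at z)"
    "\<And>z t. t > 0 \<Longrightarrow> ((\<lambda>t. heat_integral \<sigma> \<psi> z t) has_real_derivative \<sigma> * wzz z t) (at t)"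
proof -
  define prec where "prec t = 1 / (4 * \<sigma> * t)" for t
  \<comment> \<open>\<open>I\<close> and its derivative \<open>Q\<close> handle the precision; the
    moments \<open>J0\<close>, \<open>J1\<close>, \<open>J2\<close> with linear exponent handle the
    position.\<close>
  define I where "I z s = (\<integral>y. exp (s * - (z - y)\<^sup>2) * \<psi> y \<partial>lborel)" for z s
  define Q where "Q z s = (\<integral>y. exp (s * - (z - y)\<^sup>2) * (- (z - y)\<^sup>2 * \<psi> y) \<partial>lborel)" for z s
  define J0 where "J0 r s = (\<integral>y. exp (r * y) * (exp (- (s * y\<^sup>2)) * \<psi> y) \<partial>lborel)" for r s
  define J1 where "J1 r s = (\<integral>y. exp (r * y) * (y * (exp (- (s * y\<^sup>2)) * \<psi> y)) \<partial>lborel)" for r s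
  define J2 where "J2 r s = (\<integral>y. exp (r * y) * (y * (y * (exp (- (s * y\<^sup>2)) * \<psi> y))) \<partial>lborel)" for r s
  have prec_pos: "prec t > 0" if "t > 0" for t using \<sigma> that by (simp add: prec_def)
  have Is: "((\<lambda>s. I z s) has_real_derivative Q z s) (at s)" if "s > 0" for z s
    unfolding I_def Q_def
    using gaussian_integrable that
    by (intro exponential_integral_deriv(2)[where \<delta> = s]) auto
  have J0': "((\<lambda>r. J0 r s) has_real_derivative J1 r s) (at r)" if "s > 0" for r s
    unfolding J0_def J1_def using integrable_exp_linear[OF that]
    by (intro exponential_integral_deriv(2)[where \<delta> = 1]) auto
  have J1': "((\<lambda>r. J1 r s) has_real_derivative J2 r s) (at r)" if "s > 0" for r s
    unfolding J1_def J2_def using integrable_exp_linear_mult[OF that]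
    by (intro exponential_integral_deriv(2)[where \<delta> = 1]) auto
  have split: "exp (s * - (z - y)\<^sup>2) = exp (- (s * z\<^sup>2)) * (exp (2 * s * z * y) * exp (- (s * y\<^sup>2)))" for s z y :: real
    unfolding exp_add[symmetric] by (simp add: power2_diff algebra_simps)
  have I_J0: "I z s = exp (- (s * z\<^sup>2)) * J0 (2 * s * z) s" for z s
    unfolding I_def J0_def split by (simp add: mult.assoc)
  have Q_J: "Q z s = - exp (- (s * z\<^sup>2)) * (z\<^sup>2 * J0 (2 * s * z) s - 2 * z * J1 (2 * s * z) s + J2 (2 * s * z) s)"
    if "s > 0" for z s
  proof -
    let ?e = "\<lambda>y. exp (- (s * y\<^sup>2)) * \<psi> y"
    have "Q z s = (\<integral>y. - exp (- (s * z\<^sup>2)) * (z\<^sup>2 * (exp (2 * s * z * y) * ?e y)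
        - 2 * z * (exp (2 * s * z * y) * (y * ?e y)) + exp (2 * s * z * y) * (y * (y * ?e y))) \<partial>lborel)"
      unfolding Q_def split by (intro Bochner_Integration.integral_cong) (auto simp: power2_diff algebra_simps power2_eq_square)
    also have "\<dots> = - exp (- (s * z\<^sup>2)) * (z\<^sup>2 * J0 (2 * s * z) s - 2 * z * J1 (2 * s * z) s + J2 (2 * s * z) s)"
      unfolding J0_def J1_def J2_def
      using integrable_exp_linear[OF that] integrable_exp_linear_mult[OF that]
      by (subst integral_mult_right_zero, subst Bochner_Integration.integral_add,
          (intro Bochner_Integration.integrable_diff integrable_mult_right; blast), blast,
          subst Bochner_Integration.integral_diff, (intro integrable_mult_right; blast)+) simp
    finally show ?thesis .
  qed
  have W: "heat_integral \<sigma> \<psi> z t = sqrt (prec t / pi) * I z (prec t)" if "t > 0" for z t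
    unfolding heat_integral_def I_def using heat_kernel_precision[OF \<sigma> that prec_def]
    by (simp add: mult.assoc)
  define wz where "wz z t = sqrt (prec t / pi) * (exp (- (prec t * z\<^sup>2)) *
     (2 * prec t * J1 (2 * prec t * z) (prec t) - 2 * prec t * z * J0 (2 * prec t * z) (prec t)))" for z t
  \<comment> \<open>Stated with \<open>Q\<close> and \<open>I\<close> because these are the terms
    that the time derivative produces; \<open>Q_J\<close> and \<open>I_J0\<close> identify it with
    the derivative of \<open>wz\<close>.\<close>
  define wzz where "wzz z t = sqrt (prec t / pi) * (- 4 * (prec t)\<^sup>2 * Q z (prec t) - 2 * prec t * I z (prec t))" for z t
  show thesis
  proof
    fix z t :: real assume t: "t > 0"
    define s where "s = prec t"
    have s: "s > 0" using prec_pos[OF t] by (simp add: s_def)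
    have J0z: "((\<lambda>z. J0 (2 * s * z) s) has_real_derivative J1 (2 * s * z) s * (2 * s)) (at z)" for z
      by (rule DERIV_chain2[OF J0'[OF s]]) (auto intro!: derivative_eq_intros)
    have J1z: "((\<lambda>z. J1 (2 * s * z) s) has_real_derivative J2 (2 * s * z) s * (2 * s)) (at z)" for z
      by (rule DERIV_chain2[OF J1'[OF s]]) (auto intro!: derivative_eq_intros)
    show "((\<lambda>z. heat_integral \<sigma> \<psi> z t) has_real_derivative wz z t) (at z)"
      unfolding W[OF t] I_J0 wz_def s_def[symmetric]
      by (rule derivative_eq_intros J0z refl)+ (simp add: algebra_simps)
    show "((\<lambda>z. wz z t) has_real_derivative wzz z t) (at z)"
      unfolding wz_def wzz_def s_def[symmetric] Q_J[OF s] I_J0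
      by (rule derivative_eq_intros J0z J1z refl)+ (simp add: algebra_simps power2_eq_square)
    have ps: "(prec has_real_derivative - (4 * \<sigma> * s\<^sup>2)) (at t)"
      unfolding prec_def s_def using t \<sigma>
      by (auto intro!: derivative_eq_intros simp: field_simps power2_eq_square)
    have It: "((\<lambda>t. I z (prec t)) has_real_derivative Q z s * - (4 * \<sigma> * s\<^sup>2)) (at t)"
      by (rule DERIV_chain2[OF _ ps]) (use Is[OF s] s_def in simp)
    have st: "((\<lambda>t. sqrt (prec t / pi)) has_real_derivative - (2 * \<sigma> * s * sqrt (s / pi))) (at t)"
    proof -
      have "((\<lambda>t. sqrt (prec t / pi)) has_real_derivative inverse (sqrt (s / pi)) / 2 * (- (4 * \<sigma> * s\<^sup>2) / pi)) (at t)"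
        by (rule DERIV_chain2[where f = sqrt and g = "\<lambda>t. prec t / pi"])
           (use s DERIV_cdivide[OF ps, of pi] in \<open>auto simp: s_def[symmetric] intro!: DERIV_real_sqrt\<close>)
      moreover have "inverse (sqrt (s / pi)) / 2 * (- (4 * \<sigma> * s\<^sup>2) / pi) = - (2 * \<sigma> * s * sqrt (s / pi))"
        using s by (simp add: divide_simps real_sqrt_divide power2_eq_square)
      ultimately show ?thesis by simp
    qed
    have "((\<lambda>t. sqrt (prec t / pi) * I z (prec t)) has_real_derivative \<sigma> * wzz z t) (at t)"
      by (rule DERIV_cong[OF DERIV_mult[OF st It]])
        (simp add: wzz_def s_def[symmetric] algebra_simps power2_eq_square)
    then show "((\<lambda>t. heat_integral \<sigma> \<psi> z t) has_real_derivative \<sigma> * wzz z t) (at t)"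
    proof (rule DERIV_cong_ev[THEN iffD1, rotated -1, OF _ refl _ refl])
      show "\<forall>\<^sub>F t in nhds t. sqrt (prec t / pi) * I z (prec t) = heat_integral \<sigma> \<psi> z t"
        using eventually_nhds_in_open[of "{0<..}" t] t by (auto elim!: eventually_mono simp: W)
    qed
  qed
qed

text \<open>The kernel has mass 1, so near \<open>z0\<close> continuity of \<open>\<psi>\<close>
  bounds the error. Far from \<open>z0\<close>, the kernel is at most a fixed integrable Gaussian
  times a factor that tends to 0 with \<open>t\<close>. Both bounds are uniform in
  \<open>\<bar>z - z0\<bar> < d / 2\<close>, which gives the joint limit.\<close>

lemma heat_integral_initial:
  assumes \<sigma>: "\<sigma> > 0" and cont: "isCont \<psi> z0"
  shows "((\<lambda>(z, t). heat_integral \<sigma> \<psi> z t) \<longlongrightarrow> \<psi> z0) (at (z0, 0) within UNIV \<times> {0<..})"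
proof (rule tendstoI)
  fix e :: real assume e: "e > 0"
  define e' where "e' = e / 2"
  have e': "e' > 0" using e by (simp add: e'_def)
  obtain d where d: "d > 0" "\<And>y. \<bar>y - z0\<bar> < d \<Longrightarrow> \<bar>\<psi> y - \<psi> z0\<bar> < e'"
    using cont e' unfolding continuous_at_eps_delta by (auto simp: dist_real_def)
  \<comment> \<open>The fixed weight for the far part. Its precision \<open>1 / 4\<close> comes from
    \<open>\<bar>z - y\<bar> \<ge> \<bar>z0 - y\<bar> / 2\<close> together with one unit of the
    precision \<open>s\<close>.\<close>
  define D where "D y = exp (- ((z0 - y)\<^sup>2 / 4)) * \<bar>\<psi> y - \<psi> z0\<bar>" for y
  have gauss: "integrable lborel (\<lambda>y. exp (- (s * (z - y)\<^sup>2)))" if "s > 0" for s z :: real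
  proof -
    have "exp (- (s * (z - y)\<^sup>2)) = sqrt (pi / s) * heat_kernel (1 / (4 * s)) 1 (z - y)" for y
      using that by (simp add: heat_kernel_def real_sqrt_divide)
    then show ?thesis using that by (simp add: heat_kernel_normal_density)
  qed
  have D: "integrable lborel D"
  proof -
    have "integrable lborel (\<lambda>y. exp (- (1/4 * (z0 - y)\<^sup>2)) * \<psi> y - exp (- (1/4 * (z0 - y)\<^sup>2)) * \<psi> z0)"
      using gauss[of "1/4" z0] by (intro Bochner_Integration.integrable_diff gaussian_integrable) auto
    from integrable_abs[OF this] show ?thesis
      unfolding D_def right_diff_distrib[symmetric] abs_mult by simp
  qed
  define C where "C = (\<integral>y. D y \<partial>lborel)"
  define tail where "tail s = sqrt (s / pi) * exp (- ((s - 1) * d\<^sup>2 / 4)) * C" for s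
  have bound: "\<bar>heat_integral \<sigma> \<psi> z t - \<psi> z0\<bar> \<le> e' + tail (1 / (4 * \<sigma> * t))"
    if t: "t > 0" and z: "\<bar>z - z0\<bar> < d / 2" and s1: "1 / (4 * \<sigma> * t) \<ge> 1" for z t
  proof -
    define s where "s = 1 / (4 * \<sigma> * t)"
    have s: "s \<ge> 1" using s1 by (simp add: s_def)
    note K = heat_kernel_precision[OF \<sigma> t s_def]
    let ?K = "\<lambda>y. heat_kernel \<sigma> t (z - y)"
    have Kint: "integrable lborel ?K" "(\<integral>y. ?K y \<partial>lborel) = 1"
      using \<sigma> t by (simp_all add: heat_kernel_normal_density)
    have K\<psi>: "integrable lborel (\<lambda>y. ?K y * \<psi> y)"
      unfolding K using gaussian_integrable[of s z] s by (simp add: mult.assoc)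
    have pt: "\<bar>?K y * (\<psi> y - \<psi> z0)\<bar> \<le> e' * ?K y + sqrt (s / pi) * exp (- ((s - 1) * d\<^sup>2 / 4)) * D y" for y
    proof (cases "\<bar>y - z0\<bar> < d")
      case True
      have "\<bar>?K y * (\<psi> y - \<psi> z0)\<bar> = ?K y * \<bar>\<psi> y - \<psi> z0\<bar>"
        using heat_kernel_nonneg[OF \<sigma> t] by (simp add: abs_mult)
      also have "\<dots> \<le> ?K y * e'"
        using d(2)[OF True] heat_kernel_nonneg[OF \<sigma> t] by (intro mult_left_mono) auto
      also have "\<dots> \<le> e' * ?K y + sqrt (s / pi) * exp (- ((s - 1) * d\<^sup>2 / 4)) * D y"
        using s by (simp add: D_def mult.commute)
      finally show ?thesis .
    next
      case False
      \<comment> \<open>Since \<open>y\<close> is at distance at least \<open>d\<close> from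
        \<open>z0\<close> and \<open>z\<close> within \<open>d / 2\<close>, recentring at
        \<open>z0\<close> at most halves the distance. Of the \<open>s\<close> units of precision,
        \<open>s - 1\<close> are spent on the decay factor with \<open>d^2 / 4\<close>, and one is
        kept for \<open>D\<close>.\<close>
      have "\<bar>z0 - y\<bar> / 2 \<le> \<bar>z - y\<bar>" using False z by (auto simp: abs_real_def split: if_splits)
      then have "(\<bar>z0 - y\<bar> / 2)\<^sup>2 \<le> \<bar>z - y\<bar>\<^sup>2" by (intro power_mono) auto
      then have 1: "(z0 - y)\<^sup>2 / 4 \<le> (z - y)\<^sup>2" by (simp add: power_divide)
      have "d\<^sup>2 \<le> \<bar>z0 - y\<bar>\<^sup>2" using False d by (intro power_mono) auto
      then have 2: "d\<^sup>2 / 4 \<le> (z0 - y)\<^sup>2 / 4" by simp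
      have "(s - 1) * (d\<^sup>2 / 4) + (z0 - y)\<^sup>2 / 4 \<le> (s - 1) * ((z0 - y)\<^sup>2 / 4) + (z0 - y)\<^sup>2 / 4"
        using s 2 by (intro add_right_mono mult_left_mono) auto
      also have "\<dots> = s * ((z0 - y)\<^sup>2 / 4)" by (simp add: left_diff_distrib del: times_divide_eq_right)
      also have "\<dots> \<le> s * (z - y)\<^sup>2" using s 1 by (intro mult_left_mono) auto
      finally have "exp (- (s * (z - y)\<^sup>2)) \<le> exp (- ((s - 1) * d\<^sup>2 / 4)) * exp (- ((z0 - y)\<^sup>2 / 4))"
        by (simp add: exp_add[symmetric])
      then have "sqrt (s / pi) * exp (- (s * (z - y)\<^sup>2)) * \<bar>\<psi> y - \<psi> z0\<bar>
          \<le> sqrt (s / pi) * (exp (- ((s - 1) * d\<^sup>2 / 4)) * exp (- ((z0 - y)\<^sup>2 / 4))) * \<bar>\<psi> y - \<psi> z0\<bar>"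
        using s by (intro mult_right_mono mult_left_mono) auto
      then have "\<bar>?K y * (\<psi> y - \<psi> z0)\<bar> \<le> sqrt (s / pi) * exp (- ((s - 1) * d\<^sup>2 / 4)) * D y"
        using s by (simp add: K abs_mult D_def mult.assoc)
      also have "\<dots> \<le> e' * ?K y + \<dots>" using e' heat_kernel_nonneg[OF \<sigma> t] by simp
      finally show ?thesis .
    qed
    have diff: "heat_integral \<sigma> \<psi> z t - \<psi> z0 = (\<integral>y. ?K y * (\<psi> y - \<psi> z0) \<partial>lborel)"
      using Kint K\<psi> by (simp add: heat_integral_def right_diff_distrib)
    have "\<bar>heat_integral \<sigma> \<psi> z t - \<psi> z0\<bar> \<le> (\<integral>y. e' * ?K y + sqrt (s / pi) * exp (- ((s - 1) * d\<^sup>2 / 4)) * D y \<partial>lborel)"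
      unfolding diff real_norm_def[symmetric]
    proof (rule Bochner_Integration.integral_norm_bound_integral)
      show "integrable lborel (\<lambda>y. ?K y * (\<psi> y - \<psi> z0))"
        unfolding right_diff_distrib by (intro Bochner_Integration.integrable_diff K\<psi> integrable_mult_left Kint)
    qed (use pt in \<open>auto intro!: Bochner_Integration.integrable_add integrable_mult_right Kint D\<close>)
    also have "\<dots> = e' * (\<integral>y. ?K y \<partial>lborel) + sqrt (s / pi) * exp (- ((s - 1) * d\<^sup>2 / 4)) * C"
      unfolding C_def
      by (simp only: Bochner_Integration.integral_add[OF integrable_mult_right[OF Kint(1)] integrable_mult_right[OF D]]
          integral_mult_right_zero)
    also have "\<dots> = e' + tail s"
      unfolding Kint tail_def by simp
    finally show ?thesis by (simp add: s_def)
  qed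
  have "(tail \<longlongrightarrow> 0) at_top"
  proof -
    have "((\<lambda>s. sqrt (s / pi) * exp (- ((s - 1) * d\<^sup>2 / 4))) \<longlongrightarrow> 0) at_top"
      using d(1) by real_asymp
    from tendsto_mult_left_zero[OF this, of C] show ?thesis unfolding tail_def .
  qed
  moreover have "filterlim (\<lambda>t. 1 / (4 * \<sigma> * t)) at_top (at_right 0)"
    using \<sigma> by real_asymp
  ultimately have "((\<lambda>t. tail (1 / (4 * \<sigma> * t))) \<longlongrightarrow> 0) (at_right 0)"
    by (rule filterlim_compose)
  then have "\<forall>\<^sub>F t in at_right 0. tail (1 / (4 * \<sigma> * t)) < e' \<and> 1 / (4 * \<sigma> * t) \<ge> 1"
    using e' \<open>filterlim _ at_top _\<close>
    by (auto simp: order_tendsto_iff filterlim_at_top intro: eventually_conj)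
  then obtain T where T: "T > 0" "\<And>t. 0 < t \<Longrightarrow> t < T \<Longrightarrow> tail (1 / (4 * \<sigma> * t)) < e' \<and> 1 / (4 * \<sigma> * t) \<ge> 1"
    unfolding eventually_at_right_field by auto
  show "\<forall>\<^sub>F x in at (z0, 0) within UNIV \<times> {0<..}. dist (case x of (z, t) \<Rightarrow> heat_integral \<sigma> \<psi> z t) (\<psi> z0) < e"
    unfolding eventually_at
  proof (intro exI[of _ "min (d/2) T"] conjI ballI impI)
    fix x :: "real \<times> real"
    assume x: "x \<in> UNIV \<times> {0<..}" and "x \<noteq> (z0, 0) \<and> dist x (z0, 0) < min (d / 2) T"
    moreover obtain z t where [simp]: "x = (z, t)" by (cases x)
    ultimately have "t > 0" "dist z z0 < d / 2" "dist t 0 < T"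
      using dist_fst_le[of x "(z0, 0)"] dist_snd_le[of x "(z0, 0)"] by auto
    then show "dist (case x of (z, t) \<Rightarrow> heat_integral \<sigma> \<psi> z t) (\<psi> z0) < e"
      using T(2)[of t] bound[of t z] by (auto simp: dist_real_def e'_def)
  qed (use d T in auto)
qed

end

section \<open>Constancy of the potential\<close>

text \<open>In \<open>z = ln x\<close>, the condition times \<open>2 * z\<close> says that a
  function \<open>R\<close> vanishing at 0 has derivative 0; off 0, dividing \<open>R = 0\<close> by
  \<open>z^2\<close> gives the second conclusion. At 0 the differentiability of
  \<open>H z = z * \<phi> z\<close> does not determine the value of \<open>\<phi>\<close>; there the
  antiderivative \<open>F\<close> forces continuity.\<close>

lemma potential_constant:
  fixes \<sigma> A :: real and f g F h' h'' g' :: "real \<Rightarrow> real"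
  assumes sigma_pos: "\<sigma> > 0"
    and h': "\<And>x. x > 0 \<Longrightarrow> ((\<lambda>x. f x * ln x / x) has_real_derivative h' x) (at x)"
    and h'': "\<And>x. x > 0 \<Longrightarrow> (h' has_real_derivative h'' x) (at x)"
    and g': "\<And>x. x > 0 \<Longrightarrow> (g has_real_derivative g' x) (at x)"
    and condition: "\<And>x. x > 0 \<Longrightarrow>
          x\<^sup>2 / 4 * h'' x + f x / (4 * \<sigma>) * (h' x - \<sigma> / x) + x * ln x * g' x / 2 + g x = A"
    and F: "\<And>z. (F has_real_derivative exp (- z) * f (exp z)) (at z)"
  obtains \<phi>' where
    "\<And>z. ((\<lambda>z. exp (- z) * f (exp z)) has_real_derivative \<phi>' z) (at z)"
    "\<And>z. g (exp z) + (exp (- z) * f (exp z))\<^sup>2 / (4 * \<sigma>) - exp (- z) * f (exp z) / 2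
           + \<phi>' z / 2 = A"
proof -
  define \<phi> where "\<phi> z = exp (- z) * f (exp z)" for z
  define G where "G z = g (exp z)" for z
  define H where "H z = z * \<phi> z" for z
  define H1 where "H1 z = h' (exp z) * exp z" for z
  define H2 where "H2 z = h'' (exp z) * (exp z)\<^sup>2 + H1 z" for z
  define G1 where "G1 z = g' (exp z) * exp z" for z
  have G: "(G has_real_derivative G1 z) (at z)" for z
    unfolding G_def G1_def by (rule DERIV_chain2[OF g']) (auto intro!: derivative_eq_intros)
  have H_alt: "H z = f (exp z) * ln (exp z) / exp z" for z
    by (simp add: H_def \<phi>_def exp_minus divide_inverse)
  have H: "(H has_real_derivative H1 z) (at z)" for z
    unfolding H_alt H1_def by (rule DERIV_chain2[OF h']) (auto intro!: derivative_eq_intros)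
  have H': "(H1 has_real_derivative H2 z) (at z)" for z
  proof -
    have "((\<lambda>z. h' (exp z)) has_real_derivative h'' (exp z) * exp z) (at z)"
      by (rule DERIV_chain2[OF h'']) (auto intro!: derivative_eq_intros)
    then show ?thesis unfolding H1_def[abs_def] H2_def
      by (auto intro!: derivative_eq_intros simp: power2_eq_square)
  qed
  \<comment> \<open>Since \<open>x d/dx = d/dz\<close>, the term \<open>x^2 * h''\<close> becomes
    \<open>H2 - H1\<close>.\<close>
  have cond: "(H2 z - H1 z) / 4 + \<phi> z / (4 * \<sigma>) * (H1 z - \<sigma>) + z * G1 z / 2 + G z = A" for z
  proof -
    have "(exp z)\<^sup>2 / 4 * h'' (exp z) = (H2 z - H1 z) / 4" by (simp add: H2_def)
    moreover have "f (exp z) / (4 * \<sigma>) * (h' (exp z) - \<sigma> / exp z) = \<phi> z / (4 * \<sigma>) * (H1 z - \<sigma>)"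
      using sigma_pos by (simp add: \<phi>_def H1_def exp_minus field_simps)
    ultimately show ?thesis
      using condition[OF exp_gt_zero, of z] unfolding G1_def G_def by (simp only: ln_exp mult_ac)
  qed
  \<comment> \<open>As \<open>z * H1 z - H z\<close> is \<open>z^2\<close> times the derivative of
    \<open>\<phi>\<close> off 0, this is \<open>z^2\<close> times the left side of the desired
    identity minus \<open>A\<close>, written without assuming that \<open>\<phi>\<close> is
    differentiable.\<close>
  define R where "R z = z\<^sup>2 * (G z - A) + (H z)\<^sup>2 / (4 * \<sigma>) - z * H z / 2 + (z * H1 z - H z) / 2" for z
  have R': "(R has_real_derivative 0) (at z)" for z
  proof -
    have "2 * z * (G z - A) + z\<^sup>2 * G1 z + 2 * H z * H1 z / (4 * \<sigma>) - (H z + z * H1 z) / 2 + z * H2 z / 2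
       = 2 * z * ((H2 z - H1 z) / 4 + \<phi> z / (4 * \<sigma>) * (H1 z - \<sigma>) + z * G1 z / 2 + G z - A)"
      using sigma_pos by (simp add: H_def power2_eq_square field_simps)
    also have "\<dots> = 0" using cond[of z] by simp
    finally have eq: "2 * z * (G z - A) + z\<^sup>2 * G1 z + 2 * H z * H1 z / (4 * \<sigma>) - (H z + z * H1 z) / 2 + z * H2 z / 2 = 0" .
    show ?thesis unfolding R_def[abs_def]
      by (rule DERIV_cong[OF _ eq]) (rule derivative_eq_intros G H H' refl | use sigma_pos in \<open>simp; fail\<close> | simp add: algebra_simps add_divide_distrib diff_divide_distrib)+
  qed
  have R: "R z = 0" for z
    using DERIV_isconst_all[of R z 0] R' by (simp add: R_def H_def)
  have \<phi>_H: "\<phi> z = H z / z" if "z \<noteq> 0" for z using that by (simp add: H_def)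
  have H0: "H 0 = 0" by (simp add: H_def)
  have \<phi>_lim: "(\<phi> \<longlongrightarrow> H1 0) (at 0)"
  proof -
    have "((\<lambda>z. H z / z) \<longlongrightarrow> H1 0) (at 0)" using H[of 0] H0 by (simp add: DERIV_def)
    then show ?thesis
      by (rule Lim_transform_eventually) (auto simp: eventually_at_filter \<phi>_H)
  qed
  have F': "(F has_real_derivative \<phi> z) (at z)" for z using F by (simp add: \<phi>_def)
  \<comment> \<open>A derivative that has a limit at a point takes that limit as its value there;
    this fixes \<open>\<phi> 0\<close>.\<close>
  have "(F has_real_derivative H1 0) (at 0)"
    by (rule has_real_derivative_limit[OF DERIV_isCont[OF F'] F' \<phi>_lim])
  with F'[of 0] have "\<phi> 0 = H1 0" by (rule DERIV_unique)
  with \<phi>_lim have cont: "isCont \<phi> 0" by (simp add: isCont_def)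
  \<comment> \<open>Obtained by solving the desired identity for the derivative. It is then visibly
    continuous at 0, and only the derivative claim remains.\<close>
  define \<phi>' where "\<phi>' z = 2 * (A - G z - (\<phi> z)\<^sup>2 / (4 * \<sigma>) + \<phi> z / 2)" for z
  have off0: "(\<phi> has_real_derivative \<phi>' z) (at z)" if z: "z \<noteq> 0" for z
  proof -
    have "((\<lambda>z. H z / z) has_real_derivative (H1 z * z - H z) / z\<^sup>2) (at z)"
      using z by (auto intro!: derivative_eq_intros H simp: power2_eq_square)
    moreover have "(H1 z * z - H z) / z\<^sup>2 = \<phi>' z"
    proof -
      have "(z * H1 z - H z) / 2 = z\<^sup>2 * (A - G z) - (H z)\<^sup>2 / (4 * \<sigma>) + z * H z / 2"
        using R[of z] by (simp add: R_def algebra_simps)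
      then have "H1 z * z - H z = 2 * (z\<^sup>2 * (A - G z) - (H z)\<^sup>2 / (4 * \<sigma>) + z * H z / 2)" by (simp add: mult_ac)
      also have "\<dots> = z\<^sup>2 * \<phi>' z"
        by (simp add: \<phi>'_def H_def power_mult_distrib power2_eq_square algebra_simps)
      finally show ?thesis using z by simp
    qed
    ultimately have "((\<lambda>z. H z / z) has_real_derivative \<phi>' z) (at z)" by simp
    then show ?thesis
    proof (rule has_field_derivative_transform_within_open[where S = "- {0}"])
    qed (use z in \<open>auto simp: \<phi>_H\<close>)
  qed
  have "isCont \<phi>' 0"
    unfolding \<phi>'_def using cont DERIV_isCont[OF G, of 0] by (intro continuous_intros) (use sigma_pos in auto)
  then have "(\<phi> has_real_derivative \<phi>' 0) (at 0)"
    unfolding isCont_def by (rule has_real_derivative_limit[OF cont off0, rotated])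
  with off0 have "(\<phi> has_real_derivative \<phi>' z) (at z)" for z by (cases "z = 0") auto
  moreover have "G z + (\<phi> z)\<^sup>2 / (4 * \<sigma>) - \<phi> z / 2 + \<phi>' z / 2 = A" for z
    by (simp add: \<phi>'_def add_divide_distrib diff_divide_distrib)
  ultimately show thesis by (intro that[of \<phi>']) (auto simp: \<phi>_def[abs_def] G_def)
qed

section \<open>Gaussian averages of eigenfunctions\<close>

text \<open>\<open>gen_cosh l\<close> and \<open>gen_sinh l\<close> are the solutions of
  \<open>y'' = l * y\<close> with initial data (1, 0) and (0, 1), for every sign of
  \<open>l\<close>. All signs occur because the constant \<open>B\<close> may have any sign.\<close>

definition gen_cosh :: "real \<Rightarrow> real \<Rightarrow> real" where
  "gen_cosh l x = (if l > 0 then cosh (sqrt l * x) else if l = 0 then 1 else cos (sqrt (- l) * x))"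

definition gen_sinh :: "real \<Rightarrow> real \<Rightarrow> real" where
  "gen_sinh l x = (if l > 0 then sinh (sqrt l * x) / sqrt l else if l = 0 then x
     else sin (sqrt (- l) * x) / sqrt (- l))"

lemma sqrt_mult_sqrt_mult: "l \<ge> 0 \<Longrightarrow> sqrt l * (sqrt l * y) = l * y"
  by (simp add: mult.assoc[symmetric])

lemma gen_cosh_deriv: "(gen_cosh l has_real_derivative l * gen_sinh l x) (at x)"
proof -
  consider "l > 0" | "l = 0" | "l < 0" by linarith
  then show ?thesis
    by cases (auto simp: gen_cosh_def[abs_def] gen_sinh_def field_simps sqrt_mult_sqrt_mult
      intro!: derivative_eq_intros)
qed

lemma gen_sinh_deriv: "(gen_sinh l has_real_derivative gen_cosh l x) (at x)"
proof -
  consider "l > 0" | "l = 0" | "l < 0" by linarith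
  then show ?thesis
    by cases (auto simp: gen_cosh_def gen_sinh_def[abs_def] mult.assoc sqrt_mult_sqrt_mult
      mult.commute[of "cosh _"] mult.commute[of "cos _"] intro!: derivative_eq_intros)
qed

lemma gen_cosh_0 [simp]: "gen_cosh l 0 = 1" and gen_sinh_0 [simp]: "gen_sinh l 0 = 0"
  by (simp_all add: gen_cosh_def gen_sinh_def)

lemma gen_sinh_minus: "gen_sinh l (- x) = - gen_sinh l x"
  by (simp add: gen_sinh_def)

text \<open>The left side is the Wronskian of the pair: its derivative is 0 and its value at 0 is
  1.\<close>

lemma gen_cosh_sinh: "(gen_cosh l x)\<^sup>2 - l * (gen_sinh l x)\<^sup>2 = 1"
proof -
  have "((\<lambda>x. (gen_cosh l x)\<^sup>2 - l * (gen_sinh l x)\<^sup>2) has_real_derivative 0) (at x)" for x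
    by (rule derivative_eq_intros gen_cosh_deriv gen_sinh_deriv refl)+ simp
  from DERIV_isconst_all[of _ x 0, OF allI, OF this] show ?thesis by simp
qed

text \<open>Both combinations below have derivative 0; the unit Wronskian then recovers \<open>w\<close>.\<close>

lemma second_order_ode_solution:
  fixes w w' :: "real \<Rightarrow> real"
  assumes w: "\<And>x. (w has_real_derivative w' x) (at x)"
    and w': "\<And>x. (w' has_real_derivative l * w x) (at x)"
  shows "w (m + x) = w m * gen_cosh l x + w' m * gen_sinh l x"
proof -
  let ?c = "gen_cosh l" and ?s = "gen_sinh l"
  have wm: "((\<lambda>x. w (m + x)) has_real_derivative w' (m + x)) (at x)"
   and wm': "((\<lambda>x. w' (m + x)) has_real_derivative l * w (m + x)) (at x)" for x
    using DERIV_shift[of w "w' (m + x)" x m] DERIV_shift[of w' "l * w (m + x)" x m] w w'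
    by (auto simp: add.commute)
  have "((\<lambda>x. w (m + x) * ?c x - w' (m + x) * ?s x) has_real_derivative 0) (at x)" for x
    by (rule derivative_eq_intros gen_cosh_deriv gen_sinh_deriv wm wm' refl)+ (simp add: algebra_simps)
  from DERIV_isconst_all[of _ x 0, OF allI, OF this]
  have a: "w (m + x) * ?c x - w' (m + x) * ?s x = w m" by simp
  have "((\<lambda>x. w' (m + x) * ?c x - l * w (m + x) * ?s x) has_real_derivative 0) (at x)" for x
    by (rule derivative_eq_intros gen_cosh_deriv gen_sinh_deriv wm wm' refl)+ (simp add: algebra_simps)
  from DERIV_isconst_all[of _ x 0, OF allI, OF this]
  have b: "w' (m + x) * ?c x - l * w (m + x) * ?s x = w' m" by simp
  have "w m * ?c x + w' m * ?s x = w (m + x) * ((?c x)\<^sup>2 - l * (?s x)\<^sup>2)"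
    unfolding a[symmetric] b[symmetric] by (simp add: power2_eq_square algebra_simps)
  then show ?thesis by (simp add: gen_cosh_sinh)
qed

section \<open>Heat kernel averages of exponentials, cosines and ODE solutions\<close>

lemma heat_kernel_minus [simp]: "heat_kernel \<sigma> t (- x) = heat_kernel \<sigma> t x"
  by (simp add: heat_kernel_def)

lemma heat_kernel_measurable [measurable]: "heat_kernel \<sigma> t \<in> borel_measurable borel"
  unfolding heat_kernel_def by measurable

text \<open>Completing the square: an exponential factor moves the mean of the normal density to
  \<open>2 * \<sigma> * t * k\<close> and leaves a constant.\<close>

lemma heat_kernel_exp:
  assumes "\<sigma> > 0" "t > 0"
  shows "integrable lborel (\<lambda>x. heat_kernel \<sigma> t x * exp (k * x))"
    and "(\<integral>x. heat_kernel \<sigma> t x * exp (k * x) \<partial>lborel) = exp (k\<^sup>2 * \<sigma> * t)"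
proof -
  have "heat_kernel \<sigma> t x * exp (k * x) = exp (k\<^sup>2 * \<sigma> * t) * normal_density (2 * \<sigma> * t * k) (sqrt (2 * \<sigma> * t)) x" for x
  proof -
    have "- x\<^sup>2 / (4 * \<sigma> * t) + k * x = k\<^sup>2 * \<sigma> * t + - (2 * \<sigma> * t * k - x)\<^sup>2 / (4 * \<sigma> * t)"
      using assms by (simp add: power2_eq_square field_simps)
    then show ?thesis
      unfolding heat_kernel_normal_density[OF assms, symmetric] heat_kernel_def
      by (simp add: exp_add[symmetric])
  qed
  then show "integrable lborel (\<lambda>x. heat_kernel \<sigma> t x * exp (k * x))"
    and "(\<integral>x. heat_kernel \<sigma> t x * exp (k * x) \<partial>lborel) = exp (k\<^sup>2 * \<sigma> * t)"
    using assms by simp_all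
qed

text \<open>After rescaling to the standard normal law, the integral is the real part of its
  characteristic function.\<close>

lemma heat_kernel_cos:
  assumes "\<sigma> > 0" "t > 0"
  shows "(\<integral>x. heat_kernel \<sigma> t x * cos (k * x) \<partial>lborel) = exp (- k\<^sup>2 * \<sigma> * t)"
proof -
  define c where "c = sqrt (2 * \<sigma> * t)"
  have c: "c > 0" "c\<^sup>2 = 2 * \<sigma> * t" using assms by (simp_all add: c_def)
  interpret real_distribution std_normal_distribution by (rule real_dist_normal_dist)
  have *: "c * heat_kernel \<sigma> t (c * x) = std_normal_density x" for x
  proof -
    have "heat_kernel \<sigma> t (c * x) = exp (- x\<^sup>2 / 2) / (c * sqrt (2 * pi))"
      using assms c unfolding heat_kernel_def c_def
      by (simp add: power_mult_distrib field_simps real_sqrt_mult[symmetric] mult_ac)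
    then show ?thesis using c by (simp add: std_normal_density_def)
  qed
  have "(\<integral>x. heat_kernel \<sigma> t x * cos (k * x) \<partial>lborel)
      = \<bar>c\<bar> *\<^sub>R (\<integral>x. heat_kernel \<sigma> t (0 + c * x) * cos (k * (0 + c * x)) \<partial>lborel)"
    using c by (intro lborel_integral_real_affine) auto
  also have "\<dots> = (\<integral>x. std_normal_density x * cos (k * c * x) \<partial>lborel)"
    using c by (simp add: integral_mult_right_zero[symmetric] mult.assoc[symmetric] * del: integral_mult_right_zero)
  also have "\<dots> = (\<integral>x. cos (k * c * x) \<partial>std_normal_distribution)"
    by (subst integral_density) auto
  also have "\<dots> = (\<integral>x. Re (iexp (k * c * x)) \<partial>std_normal_distribution)"
    by (simp add: Re_exp)
  also have "\<dots> = Re (char std_normal_distribution (k * c))"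
    unfolding char_def by (intro integral_Re integrable_iexp) auto
  also have "\<dots> = exp (- k\<^sup>2 * \<sigma> * t)"
    using c by (simp add: char_std_normal_distribution power_mult_distrib mult_ac Re_exp)
  finally show ?thesis .
qed

lemma integrable_heat_kernel_mult:
  assumes "\<sigma> > 0" "t > 0" and [measurable]: "f \<in> borel_measurable borel"
    and "\<And>x. \<bar>f x\<bar> \<le> C * (exp (k * x) + exp (- k * x))"
  shows "integrable lborel (\<lambda>x. heat_kernel \<sigma> t x * f x)"
proof (rule Bochner_Integration.integrable_bound)
  show "integrable lborel (\<lambda>x. C * (heat_kernel \<sigma> t x * exp (k * x) + heat_kernel \<sigma> t x * exp (- k * x)))"
    by (intro integrable_mult_right Bochner_Integration.integrable_add heat_kernel_exp assms)
  show "AE x in lborel. norm (heat_kernel \<sigma> t x * f x)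
      \<le> norm (C * (heat_kernel \<sigma> t x * exp (k * x) + heat_kernel \<sigma> t x * exp (- k * x)))"
  proof (rule AE_I2)
    fix x
    have "norm (heat_kernel \<sigma> t x * f x) = heat_kernel \<sigma> t x * \<bar>f x\<bar>"
      using heat_kernel_nonneg[OF assms(1,2)] by (simp add: abs_mult)
    also have "\<dots> \<le> heat_kernel \<sigma> t x * (C * (exp (k * x) + exp (- k * x)))"
      by (intro mult_left_mono assms heat_kernel_nonneg)
    also have "\<dots> = C * (heat_kernel \<sigma> t x * exp (k * x) + heat_kernel \<sigma> t x * exp (- k * x))"
      by (simp add: algebra_simps)
    finally show "norm (heat_kernel \<sigma> t x * f x)
      \<le> norm (C * (heat_kernel \<sigma> t x * exp (k * x) + heat_kernel \<sigma> t x * exp (- k * x)))" by simp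
  qed
qed simp

lemma gen_cosh_measurable [measurable]: "gen_cosh l \<in> borel_measurable borel"
  and gen_sinh_measurable [measurable]: "gen_sinh l \<in> borel_measurable borel"
  by (rule borel_measurable_continuous_onI, rule continuous_at_imp_continuous_on,
      rule ballI, rule DERIV_isCont, rule gen_cosh_deriv gen_sinh_deriv)+

text \<open>According to the sign of \<open>l\<close>, the integrand is a mean of two exponentials,
  a constant or a cosine; the three averages share one formula.\<close>

lemma heat_kernel_gen_cosh:
  assumes "\<sigma> > 0" "t > 0"
  shows "integrable lborel (\<lambda>x. heat_kernel \<sigma> t x * gen_cosh l x)"
    and "(\<integral>x. heat_kernel \<sigma> t x * gen_cosh l x \<partial>lborel) = exp (l * \<sigma> * t)"
proof -
  consider "l > 0" | "l = 0" | "l < 0" by linarith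
  then have "integrable lborel (\<lambda>x. heat_kernel \<sigma> t x * gen_cosh l x) \<and>
    (\<integral>x. heat_kernel \<sigma> t x * gen_cosh l x \<partial>lborel) = exp (l * \<sigma> * t)"
  proof cases
    case 1
    have *: "heat_kernel \<sigma> t x * gen_cosh l x
        = (heat_kernel \<sigma> t x * exp (sqrt l * x) + heat_kernel \<sigma> t x * exp (- sqrt l * x)) / 2" for x
      using 1 by (simp add: gen_cosh_def cosh_field_def algebra_simps)
    show ?thesis
      unfolding * using 1 heat_kernel_exp[OF assms, of "sqrt l"] heat_kernel_exp[OF assms, of "- sqrt l"] by simp
  next
    case 2
    then show ?thesis
      using heat_kernel_exp[OF assms, of 0] by (simp add: gen_cosh_def)
  next
    case 3
    have "integrable lborel (\<lambda>x. heat_kernel \<sigma> t x * gen_cosh l x)"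
      using 3 by (intro integrable_heat_kernel_mult[where C = 1 and k = 0] assms)
        (auto simp: gen_cosh_def intro: order_trans[OF abs_cos_le_one])
    moreover have "(\<integral>x. heat_kernel \<sigma> t x * gen_cosh l x \<partial>lborel) = exp (l * \<sigma> * t)"
      using 3 heat_kernel_cos[OF assms, of "sqrt (- l)"] by (simp add: gen_cosh_def)
    ultimately show ?thesis by blast
  qed
  then show "integrable lborel (\<lambda>x. heat_kernel \<sigma> t x * gen_cosh l x)"
    and "(\<integral>x. heat_kernel \<sigma> t x * gen_cosh l x \<partial>lborel) = exp (l * \<sigma> * t)" by auto
qed

text \<open>An odd function against an even kernel: reflection gives the value 0. Integrability is
  established separately, by exponential bounds, so that sums containing this term can be
  split.\<close>

lemma heat_kernel_gen_sinh:
  assumes "\<sigma> > 0" "t > 0"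
  shows "integrable lborel (\<lambda>x. heat_kernel \<sigma> t x * gen_sinh l x)"
    and "(\<integral>x. heat_kernel \<sigma> t x * gen_sinh l x \<partial>lborel) = 0"
proof -
  consider "l > 0" | "l = 0" | "l < 0" by linarith
  then show "integrable lborel (\<lambda>x. heat_kernel \<sigma> t x * gen_sinh l x)"
  proof cases
    case 1
    have "\<bar>gen_sinh l x\<bar> \<le> 1 / sqrt l * (exp (sqrt l * x) + exp (- sqrt l * x))" for x
    proof -
      have "\<bar>sinh (sqrt l * x)\<bar> \<le> exp (sqrt l * x) + exp (- sqrt l * x)"
        using exp_gt_zero[of "sqrt l * x"] exp_gt_zero[of "- sqrt l * x"]
        unfolding sinh_field_def abs_le_iff by (auto simp: field_simps)
      then show ?thesis using 1 by (simp add: gen_sinh_def divide_right_mono)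
    qed
    then show ?thesis
      by (rule integrable_heat_kernel_mult[where C = "1 / sqrt l" and k = "sqrt l", OF assms gen_sinh_measurable])
  next
    case 2
    have "\<bar>gen_sinh l x\<bar> \<le> 1 * (exp (1 * x) + exp (- 1 * x))" for x
    proof -
      have "\<bar>x\<bar> \<le> exp x + exp (- x)"
        using exp_ge_add_one_self[of x] exp_ge_add_one_self[of "- x"] exp_gt_zero[of x] exp_gt_zero[of "- x"]
        by linarith
      then show ?thesis using 2 by (simp add: gen_sinh_def)
    qed
    then show ?thesis
      by (rule integrable_heat_kernel_mult[where C = "1" and k = "1", OF assms gen_sinh_measurable])
  next
    case 3
    have "\<bar>gen_sinh l x\<bar> \<le> 1 / sqrt (- l) * (exp (0 * x) + exp (- 0 * x))" for x
    proof -
      have "\<bar>sin (sqrt (- l) * x)\<bar> \<le> 2" by (rule order_trans[OF abs_sin_le_one]) simp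
      then show ?thesis using 3 by (simp add: gen_sinh_def divide_right_mono)
    qed
    then show ?thesis
      by (rule integrable_heat_kernel_mult[where C = "1 / sqrt (- l)" and k = "0", OF assms gen_sinh_measurable])
  qed
  have "(\<integral>x. heat_kernel \<sigma> t x * gen_sinh l x \<partial>lborel)
      = \<bar>- 1\<bar> *\<^sub>R (\<integral>x. heat_kernel \<sigma> t (0 + - 1 * x) * gen_sinh l (0 + - 1 * x) \<partial>lborel)"
    by (intro lborel_integral_real_affine) auto
  then show "(\<integral>x. heat_kernel \<sigma> t x * gen_sinh l x \<partial>lborel) = 0"
    by (simp add: gen_sinh_minus)
qed

text \<open>Recentred at \<open>z\<close>, \<open>w\<close> is \<open>w z\<close> times the even
  solution plus \<open>w' z\<close> times the odd one. The odd part averages out and the even part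
  gains the exponential factor. The growth control needed for integrability comes from the equation
  itself.\<close>

lemma heat_integral_eigenfunction:
  assumes "\<sigma> > 0" "t > 0"
    and w: "\<And>x. (w has_real_derivative w' x) (at x)"
    and w': "\<And>x. (w' has_real_derivative l * w x) (at x)"
  shows "integrable lborel (\<lambda>y. heat_kernel \<sigma> t (z - y) * w y)"
    and "heat_integral \<sigma> w z t = exp (l * \<sigma> * t) * w z"
proof -
  have *: "heat_kernel \<sigma> t (z - (z + 1 * x)) * w (z + 1 * x)
      = w z * (heat_kernel \<sigma> t x * gen_cosh l x) + w' z * (heat_kernel \<sigma> t x * gen_sinh l x)" for x
  proof -
    have "w (z + 1 * x) = w z * gen_cosh l x + w' z * gen_sinh l x"
      using second_order_ode_solution[OF w w', of z x] by simp
    then show ?thesis by (simp only:) (simp add: algebra_simps)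
  qed
  have "integrable lborel (\<lambda>x. heat_kernel \<sigma> t (z - (z + 1 * x)) * w (z + 1 * x))"
    unfolding * by (intro Bochner_Integration.integrable_add integrable_mult_right heat_kernel_gen_cosh
        heat_kernel_gen_sinh assms)
  then show "integrable lborel (\<lambda>y. heat_kernel \<sigma> t (z - y) * w y)"
    by (subst (asm) lborel_integrable_real_affine_iff[where f = "\<lambda>y. heat_kernel \<sigma> t (z - y) * w y"]) auto
  have "heat_integral \<sigma> w z t = (\<integral>x. heat_kernel \<sigma> t (z - (z + 1 * x)) * w (z + 1 * x) \<partial>lborel)"
    unfolding heat_integral_def
    by (subst lborel_integral_real_affine[where c = 1 and t = z]) auto
  also have "\<dots> = exp (l * \<sigma> * t) * w z"
    unfolding * using heat_kernel_gen_cosh[OF assms(1,2), of l] heat_kernel_gen_sinh[OF assms(1,2), of l]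
    by (subst Bochner_Integration.integral_add) auto
  finally show "heat_integral \<sigma> w z t = exp (l * \<sigma> * t) * w z" .
qed

text \<open>Completing the square in \<open>y\<close>: the product of the two Gaussians is again a
  heat kernel, with centre \<open>z / s\<close> and time \<open>t / s\<close>.\<close>

lemma heat_kernel_mult_gaussian:
  assumes "\<sigma> > 0" "t > 0" "\<epsilon> \<ge> 0" and s: "s = 1 + 4 * \<epsilon> * t"
  shows "exp (- \<epsilon> / \<sigma> * y\<^sup>2) * heat_kernel \<sigma> t (z - y)
     = exp (- (\<epsilon> * z\<^sup>2 / (\<sigma> * s))) / sqrt s * heat_kernel \<sigma> (t / s) (z / s - y)"
proof -
  have s0: "s > 0" using assms by (simp add: add_pos_nonneg)
  have "- \<epsilon> / \<sigma> * y\<^sup>2 + - (z - y)\<^sup>2 / (4 * \<sigma> * t)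
      = - (4 * \<epsilon> * t * y\<^sup>2 + (z - y)\<^sup>2) / (4 * \<sigma> * t)"
    using assms(1,2) by (simp add: field_simps)
  also have "4 * \<epsilon> * t * y\<^sup>2 + (z - y)\<^sup>2 = 4 * \<epsilon> * t * z\<^sup>2 / s + s * (z / s - y)\<^sup>2"
  proof -
    have "s * (4 * \<epsilon> * t * y\<^sup>2 + (z - y)\<^sup>2) = 4 * \<epsilon> * t * z\<^sup>2 + (z - s * y)\<^sup>2"
      by (simp add: s power2_eq_square algebra_simps)
    moreover have "s * (s * (z / s - y)\<^sup>2) = (z - s * y)\<^sup>2"
      using s0 by (simp add: power2_eq_square field_simps)
    \<comment> \<open>Both sides are compared after multiplication by \<open>s\<close>, where they
      are polynomials in \<open>z\<close> and \<open>y\<close>.\<close>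
    moreover have "X = N / s + Y" if "s * X = N + W" "s * Y = W" for X Y N W
    proof -
      have "s * X = s * (N / s + Y)" using that s0 by (simp add: distrib_left)
      then show ?thesis using s0 by simp
    qed
    ultimately show ?thesis by blast
  qed
  also have "- (4 * \<epsilon> * t * z\<^sup>2 / s + s * (z / s - y)\<^sup>2) / (4 * \<sigma> * t)
      = - (\<epsilon> * z\<^sup>2 / (\<sigma> * s)) + - (z / s - y)\<^sup>2 / (4 * \<sigma> * (t / s))"
    using assms(1,2) s0 by (simp add: field_simps)
  finally have "exp (- \<epsilon> / \<sigma> * y\<^sup>2) * exp (- (z - y)\<^sup>2 / (4 * \<sigma> * t))
      = exp (- (\<epsilon> * z\<^sup>2 / (\<sigma> * s))) * exp (- (z / s - y)\<^sup>2 / (4 * \<sigma> * (t / s)))"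
    unfolding exp_add[symmetric] by simp
  moreover have "sqrt (4 * pi * \<sigma> * t) = sqrt s * sqrt (4 * pi * \<sigma> * (t / s))"
    using s0 by (simp add: real_sqrt_mult[symmetric])
  ultimately show ?thesis by (simp add: heat_kernel_def)
qed

section \<open>The fundamental solution\<close>

text \<open>The equation is imposed on an open quadrant, so agreement there carries over all
  derivatives.\<close>

lemma solves_pde_cong:
  assumes "solves_pde \<sigma> f g u" and eq: "\<And>x t. x > 0 \<Longrightarrow> t > 0 \<Longrightarrow> v x t = u x t"
  shows "solves_pde \<sigma> f g v"
proof -
  from assms(1) obtain ux uxx ut where *: "\<forall>x>0. \<forall>t>0.
        ((\<lambda>x. u x t) has_real_derivative ux x t) (at x) \<and>
        ((\<lambda>x. ux x t) has_real_derivative uxx x t) (at x) \<and>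
        ((\<lambda>t. u x t) has_real_derivative ut x t) (at t) \<and>
        ut x t = \<sigma> * x\<^sup>2 * uxx x t + f x * ux x t - g x * u x t"
    unfolding solves_pde_def by (elim exE) (rule that)
  have "((\<lambda>x. v x t) has_real_derivative ux x t) (at x) \<and>
        ((\<lambda>x. ux x t) has_real_derivative uxx x t) (at x) \<and>
        ((\<lambda>t. v x t) has_real_derivative ut x t) (at t) \<and>
        ut x t = \<sigma> * x\<^sup>2 * uxx x t + f x * ux x t - g x * v x t" if "x > 0" "t > 0" for x t
  proof (intro conjI)
    note sol = *[rule_format, OF that]
    show "((\<lambda>x. v x t) has_real_derivative ux x t) (at x)"
      by (rule has_field_derivative_transform_within_open[where S = "{0<..}", OF conjunct1[OF sol]])
        (simp_all add: that eq)
    show "((\<lambda>x. ux x t) has_real_derivative uxx x t) (at x)"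
      using sol by blast
    have "((\<lambda>t. u x t) has_real_derivative ut x t) (at t)"
      using sol by blast
    then show "((\<lambda>t. v x t) has_real_derivative ut x t) (at t)"
      by (rule has_field_derivative_transform_within_open[where S = "{0<..}"]) (simp_all add: that eq)
    show "ut x t = \<sigma> * x\<^sup>2 * uxx x t + f x * ux x t - g x * v x t"
      using sol eq[OF that] by simp
  qed
  then show ?thesis unfolding solves_pde_def
    by - (rule exI[where x = ux], rule exI[where x = uxx], rule exI[where x = ut], blast)
qed

text \<open>With \<open>z = ln x\<close>, the gauge \<open>exp (- \<Phi> z)\<close> removes the first-order term of the operator, and
  \<open>B\<close> is the potential that remains.\<close>

locale constant_potential =
  fixes \<sigma> B :: real and f g \<Phi> \<Phi>' \<Phi>'' :: "real \<Rightarrow> real"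
  assumes sigma_pos: "\<sigma> > 0"
    and \<Phi>: "\<And>z. (\<Phi> has_real_derivative \<Phi>' z) (at z)"
    and \<Phi>': "\<And>z. (\<Phi>' has_real_derivative \<Phi>'' z) (at z)"
    and drift: "\<And>x. x > 0 \<Longrightarrow> f x = x * (2 * \<sigma> * \<Phi>' (ln x) + \<sigma>)"
    and potential: "\<And>x. x > 0 \<Longrightarrow> g x + \<sigma> * (\<Phi>' (ln x))\<^sup>2 + \<sigma> * \<Phi>'' (ln x) = B"
begin

text \<open>The factor \<open>1 / y\<close> is the Jacobian of \<open>ln y\<close>; it cancels when
  the integral is taken over \<open>\<zeta> = ln y\<close>.\<close>

definition gauge_kernel :: "real \<Rightarrow> real \<Rightarrow> real \<Rightarrow> real" where
  "gauge_kernel t x y = exp (- \<Phi> (ln x) - B * t) * heat_kernel \<sigma> t (ln x - ln y) * exp (\<Phi> (ln y)) / y"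

text \<open>Conjugation by \<open>exp (- \<Phi>)\<close> produces first-order terms that the drift
  cancels. The remaining zero-order terms add up to \<open>B\<close>, which the factor
  \<open>exp (- B * t)\<close> accounts for.\<close>

lemma solves_pde_gauge:
  assumes W: "\<And>z t. t > 0 \<Longrightarrow> ((\<lambda>z. W z t) has_real_derivative Wz z t) (at z)"
    and Wz: "\<And>z t. t > 0 \<Longrightarrow> ((\<lambda>z. Wz z t) has_real_derivative Wzz z t) (at z)"
    and Wt: "\<And>z t. t > 0 \<Longrightarrow> ((\<lambda>t. W z t) has_real_derivative \<sigma> * Wzz z t) (at t)"
  shows "solves_pde \<sigma> f g (\<lambda>x t. exp (- \<Phi> (ln x) - B * t) * W (ln x) t)"
proof -
  define E where "E z t = exp (- \<Phi> z - B * t)" for z t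
  define v1 where "v1 z t = E z t * (Wz z t - \<Phi>' z * W z t)" for z t
  define v2 where "v2 z t = E z t * (Wzz z t - 2 * \<Phi>' z * Wz z t + ((\<Phi>' z)\<^sup>2 - \<Phi>'' z) * W z t)" for z t
  have Ez: "((\<lambda>z. E z t) has_real_derivative - \<Phi>' z * E z t) (at z)" for z t
    unfolding E_def by (rule derivative_eq_intros \<Phi> refl)+ simp
  have Et: "((\<lambda>t. E z t) has_real_derivative - B * E z t) (at t)" for z t
    unfolding E_def by (rule derivative_eq_intros refl)+ simp
  have v1: "((\<lambda>z. E z t * W z t) has_real_derivative v1 z t) (at z)" if "t > 0" for z t
    by (rule DERIV_cong[OF DERIV_mult[OF Ez W[OF that]]]) (simp add: v1_def algebra_simps)
  have v2: "((\<lambda>z. v1 z t) has_real_derivative v2 z t) (at z)" if "t > 0" for z t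
    unfolding v1_def
    by (rule DERIV_cong[OF DERIV_mult[OF Ez DERIV_diff[OF Wz[OF that] DERIV_mult[OF \<Phi>' W[OF that]]]]])
      (simp add: v2_def algebra_simps power2_eq_square)
  have vt: "((\<lambda>t. E z t * W z t) has_real_derivative E z t * (\<sigma> * Wzz z t - B * W z t)) (at t)" if "t > 0" for z t
    by (rule DERIV_cong[OF DERIV_mult[OF Et Wt[OF that]]]) (simp add: algebra_simps)
  \<comment> \<open>Passing from \<open>z\<close> to \<open>x\<close> adds \<open>- v1\<close> to
    the second derivative; the summand \<open>\<sigma>\<close> in the drift compensates it.\<close>
  have "((\<lambda>x. E (ln x) t * W (ln x) t) has_real_derivative v1 (ln x) t / x) (at x) \<and>
        ((\<lambda>x. v1 (ln x) t / x) has_real_derivative (v2 (ln x) t - v1 (ln x) t) / x\<^sup>2) (at x) \<and>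
        ((\<lambda>t. E (ln x) t * W (ln x) t) has_real_derivative
           E (ln x) t * (\<sigma> * Wzz (ln x) t - B * W (ln x) t)) (at t) \<and>
        E (ln x) t * (\<sigma> * Wzz (ln x) t - B * W (ln x) t)
          = \<sigma> * x\<^sup>2 * ((v2 (ln x) t - v1 (ln x) t) / x\<^sup>2) + f x * (v1 (ln x) t / x)
              - g x * (E (ln x) t * W (ln x) t)" if x: "x > 0" and t: "t > 0" for x t
  proof (intro conjI vt t)
    have ln: "(ln has_real_derivative 1 / x) (at x)" using DERIV_ln_divide[OF x] .
    show "((\<lambda>x. E (ln x) t * W (ln x) t) has_real_derivative v1 (ln x) t / x) (at x)"
      using DERIV_chain2[OF v1[OF t] ln] by simp
    have "((\<lambda>x. v1 (ln x) t) has_real_derivative v2 (ln x) t * (1 / x)) (at x)"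
      using DERIV_chain2[OF v2[OF t] ln] .
    from DERIV_divide[OF this DERIV_ident] x
    show "((\<lambda>x. v1 (ln x) t / x) has_real_derivative (v2 (ln x) t - v1 (ln x) t) / x\<^sup>2) (at x)"
      by (simp add: power2_eq_square)
    have g: "g x = B - \<sigma> * (\<Phi>' (ln x))\<^sup>2 - \<sigma> * \<Phi>'' (ln x)" using potential[OF x] by simp
    have "\<sigma> * x\<^sup>2 * ((v2 (ln x) t - v1 (ln x) t) / x\<^sup>2) + f x * (v1 (ln x) t / x)
        = \<sigma> * (v2 (ln x) t - v1 (ln x) t) + (2 * \<sigma> * \<Phi>' (ln x) + \<sigma>) * v1 (ln x) t"
      using x by (simp add: drift)
    then show "E (ln x) t * (\<sigma> * Wzz (ln x) t - B * W (ln x) t)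
          = \<sigma> * x\<^sup>2 * ((v2 (ln x) t - v1 (ln x) t) / x\<^sup>2) + f x * (v1 (ln x) t / x)
              - g x * (E (ln x) t * W (ln x) t)"
      by (simp add: g v1_def v2_def power2_eq_square algebra_simps)
  qed
  then show ?thesis unfolding solves_pde_def E_def[symmetric]
    by - (rule exI[where x = "\<lambda>x t. v1 (ln x) t / x"],
        rule exI[where x = "\<lambda>x t. (v2 (ln x) t - v1 (ln x) t) / x\<^sup>2"],
        rule exI[where x = "\<lambda>x t. E (ln x) t * (\<sigma> * Wzz (ln x) t - B * W (ln x) t)"], blast)
qed

lemma exp_mult_kernel:
  "exp \<zeta> * (\<phi> (exp \<zeta>) * gauge_kernel t x (exp \<zeta>))
     = exp (- \<Phi> (ln x) - B * t) * (heat_kernel \<sigma> t (ln x - \<zeta>) * (exp (\<Phi> \<zeta>) * \<phi> (exp \<zeta>)))"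
  by (simp add: gauge_kernel_def)

lemma set_integrable_kernel_iff:
  "set_integrable lborel {0<..} (\<lambda>y. \<phi> y * gauge_kernel t x y)
     \<longleftrightarrow> integrable lborel (\<lambda>\<zeta>. heat_kernel \<sigma> t (ln x - \<zeta>) * (exp (\<Phi> \<zeta>) * \<phi> (exp \<zeta>)))"
proof -
  have "set_integrable lborel {0<..} (\<lambda>y. \<phi> y * gauge_kernel t x y)
     \<longleftrightarrow> integrable lborel (\<lambda>\<zeta>. exp \<zeta> * (\<phi> (exp \<zeta>) * gauge_kernel t x (exp \<zeta>)))"
    using set_lborel_integral_exp_substitution(1,2)[of "\<lambda>y. \<phi> y * gauge_kernel t x y"] by blast
  then show ?thesis unfolding exp_mult_kernel by simp
qed

lemma kernel_integral_heat_integral: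
  assumes "set_integrable lborel {0<..} (\<lambda>y. \<phi> y * gauge_kernel t x y)"
  shows "kernel_integral gauge_kernel \<phi> x t
    = exp (- \<Phi> (ln x) - B * t) * heat_integral \<sigma> (\<lambda>\<zeta>. exp (\<Phi> \<zeta>) * \<phi> (exp \<zeta>)) (ln x) t"
proof -
  have "kernel_integral gauge_kernel \<phi> x t = (\<integral>\<zeta>. exp \<zeta> * (\<phi> (exp \<zeta>) * gauge_kernel t x (exp \<zeta>)) \<partial>lborel)"
    unfolding kernel_integral_def
    by (rule set_lborel_integral_exp_substitution(3)[OF set_lborel_integral_exp_substitution(1)[OF assms]])
  then show ?thesis unfolding exp_mult_kernel heat_integral_def by simp
qed

section \<open>Suitable data and the initial condition\<close>

lemma continuous_on_\<Phi>: "continuous_on UNIV \<Phi>"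
  using \<Phi> by (blast intro: continuous_at_imp_continuous_on DERIV_isCont)

lemma suitable_data_compact_support:
  assumes \<phi>: "continuous_on {0<..} \<phi>" and a: "0 < a" and supp: "\<And>y. y > 0 \<Longrightarrow> y \<notin> {a..b} \<Longrightarrow> \<phi> y = 0"
  shows "suitable_data gauge_kernel \<phi>"
  unfolding suitable_data_def
proof (intro conjI allI impI \<phi>)
  fix t x :: real assume t: "t > 0"
  have "continuous_on {a..b} (\<lambda>y. \<phi> y * gauge_kernel t x y)"
    unfolding gauge_kernel_def heat_kernel_def
    using a t sigma_pos
    by (intro continuous_intros continuous_on_subset[OF \<phi>] continuous_on_compose2[OF continuous_on_\<Phi>]) auto
  then have "set_integrable lborel {a..b} (\<lambda>y. \<phi> y * gauge_kernel t x y)"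
    by (rule borel_integrable_atLeastAtMost')
  moreover have "indicator {a..b} y *\<^sub>R (\<phi> y * gauge_kernel t x y) = indicator {0<..} y *\<^sub>R (\<phi> y * gauge_kernel t x y)" for y
    using a supp[of y] by (auto simp: indicator_def)
  ultimately show "set_integrable lborel {0<..} (\<lambda>y. \<phi> y * gauge_kernel t x y)"
    unfolding set_integrable_def by (simp only:)
qed

text \<open>Suitability holds at all times and all points, and
  \<open>t = 1 / (4 * \<sigma> * s)\<close> with \<open>x = exp z\<close> realises every precision
  \<open>s\<close> and every centre \<open>z\<close>.\<close>

lemma gaussian_integrable_suitable:
  assumes "suitable_data gauge_kernel \<phi>"
  shows "gaussian_integrable (\<lambda>\<zeta>. exp (\<Phi> \<zeta>) * \<phi> (exp \<zeta>))"
proof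
  fix s z :: real assume s: "s > 0"
  define t where "t = 1 / (4 * \<sigma> * s)"
  have t: "t > 0" "s = 1 / (4 * \<sigma> * t)" using s sigma_pos by (simp_all add: t_def)
  have "set_integrable lborel {0<..} (\<lambda>y. \<phi> y * gauge_kernel t (exp z) y)"
    using assms t(1) unfolding suitable_data_def by simp
  then have "integrable lborel (\<lambda>\<zeta>. heat_kernel \<sigma> t (z - \<zeta>) * (exp (\<Phi> \<zeta>) * \<phi> (exp \<zeta>)))"
    unfolding set_integrable_kernel_iff by simp
  then show "integrable lborel (\<lambda>\<zeta>. exp (- (s * (z - \<zeta>)\<^sup>2)) * (exp (\<Phi> \<zeta>) * \<phi> (exp \<zeta>)))"
    unfolding heat_kernel_precision[OF sigma_pos t] using s by (simp add: mult.assoc)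
qed

lemma fundamental_solution_kernel: "fundamental_solution \<sigma> f g gauge_kernel"
  unfolding fundamental_solution_def
proof (intro conjI allI impI)
  fix \<phi> :: "real \<Rightarrow> real" and a b :: real
  assume "continuous_on {0<..} \<phi> \<and> 0 < a \<and> (\<forall>y>0. y \<notin> {a..b} \<longrightarrow> \<phi> y = 0)"
  then show "suitable_data gauge_kernel \<phi>" using suitable_data_compact_support[of \<phi> a b] by blast
next
  fix \<phi> :: "real \<Rightarrow> real" assume \<phi>: "suitable_data gauge_kernel \<phi>"
  define \<psi> where "\<psi> \<zeta> = exp (\<Phi> \<zeta>) * \<phi> (exp \<zeta>)" for \<zeta>
  interpret gaussian_integrable \<psi>
    unfolding \<psi>_def using \<phi> by (rule gaussian_integrable_suitable)
  have kernel_integral: "kernel_integral gauge_kernel \<phi> x t = exp (- \<Phi> (ln x) - B * t) * heat_integral \<sigma> \<psi> (ln x) t"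
    if "x > 0" "t > 0" for x t
    unfolding \<psi>_def using \<phi> that by (intro kernel_integral_heat_integral) (auto simp: suitable_data_def)
  obtain wz wzz where W:
    "\<And>z t. t > 0 \<Longrightarrow> ((\<lambda>z. heat_integral \<sigma> \<psi> z t) has_real_derivative wz z t) (at z)"
    "\<And>z t. t > 0 \<Longrightarrow> ((\<lambda>z. wz z t) has_real_derivative wzz z t) (at z)"
    "\<And>z t. t > 0 \<Longrightarrow> ((\<lambda>t. heat_integral \<sigma> \<psi> z t) has_real_derivative \<sigma> * wzz z t) (at t)"
    using heat_equation[OF sigma_pos] by blast
  have "solves_pde \<sigma> f g (\<lambda>x t. exp (- \<Phi> (ln x) - B * t) * heat_integral \<sigma> \<psi> (ln x) t)"
    using W by (rule solves_pde_gauge)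
  then show "solves_pde \<sigma> f g (kernel_integral gauge_kernel \<phi>)"
    by (rule solves_pde_cong) (rule kernel_integral)
  fix x0 :: real assume x0: "x0 > 0"
  let ?F = "at (x0, 0::real) within {0<..} \<times> {0<..}"
  have "isCont \<phi> (exp (ln x0))"
    using \<phi> x0 continuous_on_eq_continuous_at[of "{0<..}" \<phi>] by (simp add: suitable_data_def)
  then have cont: "isCont \<psi> (ln x0)"
    unfolding \<psi>_def by (intro continuous_intros DERIV_isCont[OF \<Phi>] isCont_o2[where f = exp and g = \<phi>]) auto
  have fst: "(fst \<longlongrightarrow> x0) ?F" and snd: "(snd \<longlongrightarrow> 0) ?F"
    using tendsto_fst[OF tendsto_ident_at, of "(x0, 0::real)" "{0<..} \<times> {0<..}"]
      tendsto_snd[OF tendsto_ident_at, of "(x0, 0::real)" "{0<..} \<times> {0<..}"] by simp_all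
  have ln: "((\<lambda>p. ln (fst p)) \<longlongrightarrow> ln x0) ?F"
    using fst x0 by (intro tendsto_ln) auto
  \<comment> \<open>The image avoids the limit point itself because its time coordinate stays
    positive.\<close>
  have lim: "filterlim (\<lambda>p. (ln (fst p), snd p)) (at (ln x0, 0) within UNIV \<times> {0<..}) ?F"
    unfolding filterlim_at
    using tendsto_Pair[OF ln snd] unfolding eventually_at_filter by (auto intro!: always_eventually)
  have "((\<lambda>p. heat_integral \<sigma> \<psi> (ln (fst p)) (snd p)) \<longlongrightarrow> \<psi> (ln x0)) ?F"
    using filterlim_compose[OF heat_integral_initial[OF sigma_pos cont] lim] by simp
  moreover have "((\<lambda>p. exp (- \<Phi> (ln (fst p)) - B * snd p)) \<longlongrightarrow> exp (- \<Phi> (ln x0) - B * 0)) ?F"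
    by (intro tendsto_intros isCont_tendsto_compose[OF DERIV_isCont[OF \<Phi>]] ln snd)
  ultimately have "((\<lambda>p. exp (- \<Phi> (ln (fst p)) - B * snd p) * heat_integral \<sigma> \<psi> (ln (fst p)) (snd p))
      \<longlongrightarrow> exp (- \<Phi> (ln x0) - B * 0) * \<psi> (ln x0)) ?F"
    by (intro tendsto_mult)
  also have "exp (- \<Phi> (ln x0) - B * 0) * \<psi> (ln x0) = \<phi> x0"
    using x0 by (simp add: \<psi>_def exp_minus)
  finally show "((\<lambda>(x, t). kernel_integral gauge_kernel \<phi> x t) \<longlongrightarrow> \<phi> x0) ?F"
  proof (rule Lim_transform_eventually)
    show "\<forall>\<^sub>F p in ?F. exp (- \<Phi> (ln (fst p)) - B * snd p) * heat_integral \<sigma> \<psi> (ln (fst p)) (snd p)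
        = (case p of (x, t) \<Rightarrow> kernel_integral gauge_kernel \<phi> x t)"
      unfolding eventually_at_filter by (auto intro!: always_eventually simp: kernel_integral)
  qed
qed

text \<open>The same gauge as for the kernel, now without time: the first-order terms cancel and
  \<open>\<sigma> * w'' = B * w\<close> remains.\<close>

lemma stationary_eigenfunction:
  assumes "stationary_solution \<sigma> f g u0"
  obtains w' where "\<And>z. ((\<lambda>z. exp (\<Phi> z) * u0 (exp z)) has_real_derivative w' z) (at z)"
    "\<And>z. (w' has_real_derivative B / \<sigma> * (exp (\<Phi> z) * u0 (exp z))) (at z)"
proof -
  from assms obtain ux uxx ut where *: "\<forall>x>0. \<forall>t>0.
        (u0 has_real_derivative ux x t) (at x) \<and>
        ((\<lambda>x. ux x t) has_real_derivative uxx x t) (at x) \<and>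
        ((\<lambda>t. u0 x) has_real_derivative ut x t) (at t) \<and>
        ut x t = \<sigma> * x\<^sup>2 * uxx x t + f x * ux x t - g x * u0 x"
    unfolding stationary_solution_def solves_pde_def by (elim exE) (rule that)
  \<comment> \<open>The derivative witnesses may formally depend on \<open>t\<close>, so they are
    frozen at \<open>t = 1\<close>.\<close>
  define u1 where "u1 x = ux x 1" for x
  define u2 where "u2 x = uxx x 1" for x
  have u0: "(u0 has_real_derivative u1 x) (at x)" and u1: "(u1 has_real_derivative u2 x) (at x)"
    if "x > 0" for x
    using *[rule_format, OF that zero_less_one] by (simp_all add: u1_def[abs_def] u2_def)
  have eq: "\<sigma> * x\<^sup>2 * u2 x + f x * u1 x - g x * u0 x = 0" if "x > 0" for x
  proof -
    have "((\<lambda>t. u0 x) has_real_derivative ut x 1) (at 1)"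
      using *[rule_format, OF that zero_less_one] by blast
    then have "ut x 1 = 0" by (rule DERIV_unique[OF _ DERIV_const])
    then show ?thesis using *[rule_format, OF that zero_less_one] by (simp add: u1_def u2_def)
  qed
  have u0_exp: "((\<lambda>z. u0 (exp z)) has_real_derivative u1 (exp z) * exp z) (at z)"
   and u1_exp: "((\<lambda>z. u1 (exp z)) has_real_derivative u2 (exp z) * exp z) (at z)" for z
    by (rule DERIV_chain2[OF u0] DERIV_chain2[OF u1], simp, rule DERIV_exp)+
  define w' where "w' z = exp (\<Phi> z) * (\<Phi>' z * u0 (exp z) + exp z * u1 (exp z))" for z
  show thesis
  proof
    fix z
    show "((\<lambda>z. exp (\<Phi> z) * u0 (exp z)) has_real_derivative w' z) (at z)"
      unfolding w'_def by (rule derivative_eq_intros \<Phi> u0_exp refl)+ (simp add: algebra_simps)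
    have "\<sigma> * (exp z)\<^sup>2 * u2 (exp z) = g (exp z) * u0 (exp z) - exp z * (2 * \<sigma> * \<Phi>' z + \<sigma>) * u1 (exp z)"
      using eq[of "exp z"] drift[of "exp z"] by simp
    moreover have "g (exp z) = B - \<sigma> * (\<Phi>' z)\<^sup>2 - \<sigma> * \<Phi>'' z" using potential[of "exp z"] by simp
    ultimately have "\<sigma> * (((\<Phi>' z)\<^sup>2 + \<Phi>'' z) * u0 (exp z) + (2 * \<Phi>' z + 1) * exp z * u1 (exp z) + (exp z)\<^sup>2 * u2 (exp z))
        = B * u0 (exp z)"
      by (simp add: algebra_simps)
    then have **: "((\<Phi>' z)\<^sup>2 + \<Phi>'' z) * u0 (exp z) + (2 * \<Phi>' z + 1) * exp z * u1 (exp z) + (exp z)\<^sup>2 * u2 (exp z)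
        = B / \<sigma> * u0 (exp z)"
      using sigma_pos by (simp add: field_simps)
    have "(w' has_real_derivative exp (\<Phi> z) * (((\<Phi>' z)\<^sup>2 + \<Phi>'' z) * u0 (exp z)
        + (2 * \<Phi>' z + 1) * exp z * u1 (exp z) + (exp z)\<^sup>2 * u2 (exp z))) (at z)"
      unfolding w'_def[abs_def]
      by (rule derivative_eq_intros \<Phi> \<Phi>' u0_exp u1_exp refl)+ (simp add: algebra_simps power2_eq_square)
    then show "(w' has_real_derivative B / \<sigma> * (exp (\<Phi> z) * u0 (exp z))) (at z)"
      unfolding ** by (simp add: mult_ac)
  qed
qed

text \<open>The Gaussian factor is absorbed into a heat kernel of time \<open>t / s\<close> centred
  at \<open>ln x / s\<close>. The gauged \<open>u0\<close> is an eigenfunction with eigenvalue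
  \<open>B / \<sigma>\<close>, so its average is its value at that centre times
  \<open>exp (B * t / s)\<close>.\<close>

lemma gaussian_stationary_integral:
  assumes u0: "stationary_solution \<sigma> f g u0" and \<epsilon>: "\<epsilon> \<ge> 0" and t: "t > 0" and s: "s = 1 + 4 * \<epsilon> * t"
  shows "set_integrable lborel {0<..} (\<lambda>y. exp (- \<epsilon> / \<sigma> * (ln y)\<^sup>2) * u0 y * gauge_kernel t x y)"
    and "kernel_integral gauge_kernel (\<lambda>y. exp (- \<epsilon> / \<sigma> * (ln y)\<^sup>2) * u0 y) x t
      = exp (- \<Phi> (ln x) - B * t) * (exp (- (\<epsilon> * (ln x)\<^sup>2 / (\<sigma> * s))) / sqrt s
          * (exp (B * t / s) * (exp (\<Phi> (ln x / s)) * u0 (exp (ln x / s)))))"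
proof -
  define w where "w z = exp (\<Phi> z) * u0 (exp z)" for z
  obtain w' where w: "\<And>z. (w has_real_derivative w' z) (at z)"
    and w': "\<And>z. (w' has_real_derivative B / \<sigma> * w z) (at z)"
    using stationary_eigenfunction[OF u0] unfolding w_def[abs_def] by blast
  have "s > 0" using s \<epsilon> t by (simp add: add_pos_nonneg)
  then have ts: "t / s > 0" using t by simp
  have *: "heat_kernel \<sigma> t (ln x - \<zeta>) * (exp (\<Phi> \<zeta>) * (exp (- \<epsilon> / \<sigma> * (ln (exp \<zeta>))\<^sup>2) * u0 (exp \<zeta>)))
      = exp (- (\<epsilon> * (ln x)\<^sup>2 / (\<sigma> * s))) / sqrt s * (heat_kernel \<sigma> (t / s) (ln x / s - \<zeta>) * w \<zeta>)" for \<zeta>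
    using heat_kernel_mult_gaussian[OF sigma_pos t \<epsilon> s, of \<zeta> "ln x"] by (simp add: w_def mult_ac)
  show int: "set_integrable lborel {0<..} (\<lambda>y. exp (- \<epsilon> / \<sigma> * (ln y)\<^sup>2) * u0 y * gauge_kernel t x y)"
    unfolding set_integrable_kernel_iff *
    by (intro integrable_mult_right heat_integral_eigenfunction[OF sigma_pos ts w w'])
  have "heat_integral \<sigma> (\<lambda>\<zeta>. exp (\<Phi> \<zeta>) * (exp (- \<epsilon> / \<sigma> * (ln (exp \<zeta>))\<^sup>2) * u0 (exp \<zeta>))) (ln x) t
      = exp (- (\<epsilon> * (ln x)\<^sup>2 / (\<sigma> * s))) / sqrt s * heat_integral \<sigma> w (ln x / s) (t / s)"
    unfolding heat_integral_def * by (rule integral_mult_right_zero)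
  also have "heat_integral \<sigma> w (ln x / s) (t / s) = exp (B * t / s) * w (ln x / s)"
    using heat_integral_eigenfunction(2)[OF sigma_pos ts w w'] sigma_pos by simp
  finally show "kernel_integral gauge_kernel (\<lambda>y. exp (- \<epsilon> / \<sigma> * (ln y)\<^sup>2) * u0 y) x t
      = exp (- \<Phi> (ln x) - B * t) * (exp (- (\<epsilon> * (ln x)\<^sup>2 / (\<sigma> * s))) / sqrt s
          * (exp (B * t / s) * (exp (\<Phi> (ln x / s)) * u0 (exp (ln x / s)))))"
    unfolding kernel_integral_heat_integral[OF int] w_def by simp
qed

end

theorem theorem3p4:
  fixes \<sigma> A :: real and f g F u0 h' h'' g' :: "real \<Rightarrow> real"
  assumes sigma_pos: "\<sigma> > 0"
    and h': "\<And>x. x > 0 \<Longrightarrow> ((\<lambda>x. f x * ln x / x) has_real_derivative h' x) (at x)"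
    and h'': "\<And>x. x > 0 \<Longrightarrow> (h' has_real_derivative h'' x) (at x)"
    and g': "\<And>x. x > 0 \<Longrightarrow> (g has_real_derivative g' x) (at x)"
    and condition: "\<And>x. x > 0 \<Longrightarrow>
          x\<^sup>2 / 4 * h'' x + f x / (4 * \<sigma>) * (h' x - \<sigma> / x) + x * ln x * g' x / 2 + g x = A"
    and F: "\<And>z. (F has_real_derivative exp (- z) * f (exp z)) (at z)"
    and stationary: "stationary_solution \<sigma> f g u0"
    and analytic: "analytic_near_zero u0"
  shows "\<exists>p. fundamental_solution \<sigma> f g p \<and>
           (\<forall>\<epsilon>\<ge>0. \<forall>t>0. \<forall>x>0.
              set_integrable lborel {0<..} (\<lambda>y. exp (- \<epsilon> / \<sigma> * (ln y)\<^sup>2) * p t x y * u0 y) \<and>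
              (LBINT y:{0<..}. exp (- \<epsilon> / \<sigma> * (ln y)\<^sup>2) * p t x y * u0 y) = U \<sigma> A F u0 \<epsilon> x t)"
proof -
  define \<phi> where "\<phi> z = exp (- z) * f (exp z)" for z
  obtain \<phi>' where \<phi>': "\<And>z. (\<phi> has_real_derivative \<phi>' z) (at z)"
    and A: "\<And>z. g (exp z) + (\<phi> z)\<^sup>2 / (4 * \<sigma>) - \<phi> z / 2 + \<phi>' z / 2 = A"
    using potential_constant[OF sigma_pos h' h'' g' condition F] unfolding \<phi>_def[abs_def] by blast
  \<comment> \<open>In \<open>z = ln x\<close> the operator is
    \<open>\<sigma> u_zz + (\<phi> - \<sigma>) u_z - g u\<close>; removing the first-order term
    requires \<open>2 * \<sigma> * \<Phi>' = \<phi> - \<sigma>\<close>.\<close>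
  define \<Phi> where "\<Phi> z = (F z - \<sigma> * z) / (2 * \<sigma>)" for z
  define \<Phi>' where "\<Phi>' z = (\<phi> z - \<sigma>) / (2 * \<sigma>)" for z
  define \<Phi>'' where "\<Phi>'' z = \<phi>' z / (2 * \<sigma>)" for z
  interpret constant_potential \<sigma> "A + \<sigma> / 4" f g \<Phi> \<Phi>' \<Phi>''
  proof
    show "(\<Phi> has_real_derivative \<Phi>' z) (at z)" for z
      unfolding \<Phi>_def[abs_def] \<Phi>'_def \<phi>_def
      using sigma_pos by (auto intro!: derivative_eq_intros F simp: field_simps)
    show "(\<Phi>' has_real_derivative \<Phi>'' z) (at z)" for z
      unfolding \<Phi>'_def[abs_def] \<Phi>''_def
      using sigma_pos by (auto intro!: derivative_eq_intros \<phi>' simp: field_simps)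
    fix x :: real assume x: "x > 0"
    show "f x = x * (2 * \<sigma> * \<Phi>' (ln x) + \<sigma>)"
      using x sigma_pos by (simp add: \<Phi>'_def \<phi>_def exp_minus)
    show "g x + \<sigma> * (\<Phi>' (ln x))\<^sup>2 + \<sigma> * \<Phi>'' (ln x) = A + \<sigma> / 4"
    proof -
      \<comment> \<open>Expanding \<open>(\<phi> - \<sigma>)^2 / (4 * \<sigma>)\<close> leaves the
        summand \<open>\<sigma> / 4\<close>, the difference between \<open>B\<close> and
        \<open>A\<close>.\<close>
      have "\<sigma> * (\<Phi>' (ln x))\<^sup>2 = (\<phi> (ln x))\<^sup>2 / (4 * \<sigma>) - \<phi> (ln x) / 2 + \<sigma> / 4"
        using sigma_pos by (simp add: \<Phi>'_def power2_eq_square field_simps)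
      then show ?thesis using A[of "ln x"] x sigma_pos by (simp add: \<Phi>''_def)
    qed
  qed (rule sigma_pos)
  have "set_integrable lborel {0<..} (\<lambda>y. exp (- \<epsilon> / \<sigma> * (ln y)\<^sup>2) * gauge_kernel t x y * u0 y)"
    "(LBINT y:{0<..}. exp (- \<epsilon> / \<sigma> * (ln y)\<^sup>2) * gauge_kernel t x y * u0 y) = U \<sigma> A F u0 \<epsilon> x t"
    if \<epsilon>: "\<epsilon> \<ge> 0" and t: "t > 0" and x: "x > 0" for \<epsilon> t x
  proof -
    define s where "s = 1 + 4 * \<epsilon> * t"
    define z where "z = ln x"
    have s: "s > 0" using \<epsilon> t by (simp add: s_def add_pos_nonneg)
    note integral = gaussian_stationary_integral[OF stationary \<epsilon> t s_def, of x]
    have swap: "exp (- \<epsilon> / \<sigma> * (ln y)\<^sup>2) * gauge_kernel t x y * u0 y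
        = exp (- \<epsilon> / \<sigma> * (ln y)\<^sup>2) * u0 y * gauge_kernel t x y" for y by simp
    show "set_integrable lborel {0<..} (\<lambda>y. exp (- \<epsilon> / \<sigma> * (ln y)\<^sup>2) * gauge_kernel t x y * u0 y)"
      unfolding swap by (rule integral)
    \<comment> \<open>The linear part of \<open>\<Phi>\<close> contributes the term in
      \<open>t * z\<close>. The term in \<open>t^2\<close> comes from
      \<open>B * t / s - B * t\<close>, because \<open>1 / s - 1 = - 4 * \<epsilon> * t / s\<close>
      and \<open>4 * B = 4 * A + \<sigma>\<close>.\<close>
    have exponent: "- \<Phi> z - (A + \<sigma> / 4) * t + (- (\<epsilon> * z\<^sup>2 / (\<sigma> * s)) + ((A + \<sigma> / 4) * t / s + \<Phi> (z / s)))
        = - (\<epsilon> * (z\<^sup>2 - 2 * \<sigma> * t * z + (4 * A + \<sigma>) * \<sigma> * t\<^sup>2) / (\<sigma> * s))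
          + 1 / (2 * \<sigma>) * (F (z / s) - F z)"
    proof -
      have "\<Phi> (z / s) - \<Phi> z = 1 / (2 * \<sigma>) * (F (z / s) - F z) + z / 2 - z / (2 * s)"
        using sigma_pos s by (simp add: \<Phi>_def field_simps)
      moreover have "z / 2 - z / (2 * s) = 2 * \<epsilon> * t * z / s"
        using s by (simp add: field_simps) (simp add: s_def algebra_simps)
      moreover have "(A + \<sigma> / 4) * t / s - (A + \<sigma> / 4) * t = - \<epsilon> * (4 * A + \<sigma>) * t\<^sup>2 / s"
        using s by (simp add: field_simps) (simp add: s_def algebra_simps power2_eq_square)
      moreover have "\<epsilon> * (z\<^sup>2 - 2 * \<sigma> * t * z + (4 * A + \<sigma>) * \<sigma> * t\<^sup>2) / (\<sigma> * s)
          = \<epsilon> * z\<^sup>2 / (\<sigma> * s) - 2 * \<epsilon> * t * z / s + \<epsilon> * (4 * A + \<sigma>) * t\<^sup>2 / s"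
        using sigma_pos s by (simp add: field_simps)
      ultimately show ?thesis by simp
    qed
    have "(LBINT y:{0<..}. exp (- \<epsilon> / \<sigma> * (ln y)\<^sup>2) * gauge_kernel t x y * u0 y)
        = exp (- \<Phi> z - (A + \<sigma> / 4) * t) * (exp (- (\<epsilon> * z\<^sup>2 / (\<sigma> * s))) / sqrt s
          * (exp ((A + \<sigma> / 4) * t / s) * (exp (\<Phi> (z / s)) * u0 (exp (z / s)))))"
      unfolding swap z_def using integral(2) by (simp only: kernel_integral_def)
    also have "\<dots> = exp (- \<Phi> z - (A + \<sigma> / 4) * t + (- (\<epsilon> * z\<^sup>2 / (\<sigma> * s)) + ((A + \<sigma> / 4) * t / s + \<Phi> (z / s))))
          / sqrt s * u0 (exp (z / s))"
      unfolding exp_add by simp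
    also have "\<dots> = U \<sigma> A F u0 \<epsilon> x t"
      unfolding exponent exp_add U_def s_def[symmetric] z_def[symmetric]
      using x by (simp add: powr_def z_def)
    finally show "(LBINT y:{0<..}. exp (- \<epsilon> / \<sigma> * (ln y)\<^sup>2) * gauge_kernel t x y * u0 y) = U \<sigma> A F u0 \<epsilon> x t" .
  qed
  with fundamental_solution_kernel show ?thesis by blast
qed

end
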